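(* Let $0<q<1$, let $r$ be a positive integer, and let $m,n$ be either both non-negative integers or both positive half-integers. Then $$\sum_{k_1,\dots,k_r=-n}^n\ \prod_{1\le i<j\le r}[k_j-k_i]_q^2\,[k_i+k_j]_q^2\ \prod_{i=1}^r q^{k_i^2-(2i-\frac12)k_i}\,\big|[k_i]_{q^2}\,[k_i]_q\big|\begin{bmatrix}2n\\ n+k_i\end{bmatrix}_q\begin{bmatrix}2m\\ m+k_i\end{bmatrix}_q$$ $$=r!\Big(\frac{2}{[2]_q}\Big)^r[2]_{q^{1/2}}^{-r}\,q^{-2\binom{r+1}{3}-\frac12\binom{r+1}{2}}\prod_{i=1}^r\Bigg(\frac{\Gamma_{q^{1/2}}(2i)\,\Gamma_q(2n+1)\,\Gamma_q(2m+1)}{\Gamma_q(m+n-i+2)\,\Gamma_q(m+n-i-r+2)}\cdot\frac{\Gamma_{q^{1/2}}(2m+2n-2i-2r+3)}{\Gamma_{q^{1/2}}(2n-2i+2)\,\Gamma_{q^{1/2}}(2m-2i+2)}\Bigg).$$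
   Context: Each $k_i$ runs over $\{-n,-n+1,\dots,n\}$ (half-integers, i.e. elements of $\frac12+\mathbb{Z}$, if $n$ is a half-integer). Notation: $(a;q)_\infty=\prod_{k\ge1}(1-aq^{k-1})$; $(a;q)_k=\prod_{j=1}^k(1-aq^{j-1})$; $\begin{bmatrix}N\\ M\end{bmatrix}_q=\frac{(q;q)_N}{(q;q)_M(q;q)_{N-M}}$ for integers $0\le M\le N$, and $0$ for integers $M<0$ or $M>N$; $[x]_q=\frac{1-q^x}{1-q}$ (and similarly $[x]_{q^2}$, $[x]_{q^{1/2}}$); $\Gamma_q(x)=(1-q)^{1-x}\frac{(q;q)_\infty}{(q^x;q)_\infty}$, so $1/\Gamma_q(x)=0$ for $x\in\{0,-1,-2,\dots\}$. If a numerator factor on the right-hand side has a pole, the right-hand side is understood as its limiting value when $m,n$ are replaced by $m+\varepsilon,n+\varepsilon$ and $\varepsilon\to0$. *)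

theory Defs
  imports "HOL-Analysis.Analysis"
begin

definition q_pochhammer :: "real \<Rightarrow> real \<Rightarrow> nat \<Rightarrow> real" where
  "q_pochhammer a q k = (\<Prod>j = 1..k. 1 - a * q ^ (j - 1))"

definition q_pochhammer_inf :: "real \<Rightarrow> real \<Rightarrow> real" where
  "q_pochhammer_inf a q = (\<Prod>k. 1 - a * q ^ k)"

definition q_binomial :: "real \<Rightarrow> int \<Rightarrow> int \<Rightarrow> real" where
  "q_binomial q N M =
     (if 0 \<le> M \<and> M \<le> N
      then q_pochhammer q q (nat N) / (q_pochhammer q q (nat M) * q_pochhammer q q (nat (N - M)))
      else 0)"

definition q_number :: "real \<Rightarrow> real \<Rightarrow> real" where
  "q_number q x = (1 - q powr x) / (1 - q)"

text \<open>
  For \<open>0 < q < 1\<close> the poles on the real line are exactly the points of \<open>\<int>\<^sub>\<le>\<^sub>0\<close>. There the infinite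
  product in the denominator vanishes, so division by zero makes \<open>q_Gamma q x = 0\<close> and hence
  \<open>1 / q_Gamma q x = 0\<close>, which is the value of the entire function \<open>1 / \<Gamma>\<^sub>q\<close> at these points.
\<close>
definition q_Gamma :: "real \<Rightarrow> real \<Rightarrow> real" where
  "q_Gamma q x = (1 - q) powr (1 - x) * q_pochhammer_inf q q / q_pochhammer_inf (q powr x) q"

definition k_range :: "real \<Rightarrow> real set" where
  "k_range n = {k. \<exists>j::nat. k = - n + real j \<and> k \<le> n}"

lemma finite_k_range: "finite (k_range n)"
proof (rule finite_subset)
  show "k_range n \<subseteq> (\<lambda>j. - n + real j) ` {..nat \<lfloor>2 * n\<rfloor>}"
    by (auto simp: k_range_def le_nat_floor)
qed simp

text \<open>
  When \<open>m, n\<close> are both integers or both half-integers and \<open>k \<in> k_range n\<close>, the numbers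
  \<open>2 * n\<close>, \<open>2 * m\<close>, \<open>n + k\<close>, \<open>m + k\<close> are integers, so the floors below only change the type.
\<close>
definition lhs_sum :: "real \<Rightarrow> nat \<Rightarrow> real \<Rightarrow> real \<Rightarrow> real" where
  "lhs_sum q r m n =
     (\<Sum>k \<in> {1..r} \<rightarrow>\<^sub>E k_range n.
        (\<Prod>(i, j) \<in> {(i, j). 1 \<le> i \<and> i < j \<and> j \<le> r}.
           (q_number q (k j - k i))\<^sup>2 * (q_number q (k i + k j))\<^sup>2) *
        (\<Prod>i = 1..r.
           q powr ((k i)\<^sup>2 - (2 * real i - 1 / 2) * k i) *
           \<bar>q_number (q\<^sup>2) (k i) * q_number q (k i)\<bar> *
           q_binomial q \<lfloor>2 * n\<rfloor> \<lfloor>n + k i\<rfloor> *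
           q_binomial q \<lfloor>2 * m\<rfloor> \<lfloor>m + k i\<rfloor>))"

definition rhs_product :: "real \<Rightarrow> nat \<Rightarrow> real \<Rightarrow> real \<Rightarrow> real" where
  "rhs_product q r m n =
     fact r * (2 / q_number q 2) ^ r * q_number (q powr (1 / 2)) 2 powi (- int r) *
     q powr (- 2 * real ((r + 1) choose 3) - 1 / 2 * real ((r + 1) choose 2)) *
     (\<Prod>i = 1..r.
        (q_Gamma (q powr (1 / 2)) (2 * real i) * q_Gamma q (2 * n + 1) * q_Gamma q (2 * m + 1) /
         (q_Gamma q (m + n - real i + 2) * q_Gamma q (m + n - real i - real r + 2))) *
        (q_Gamma (q powr (1 / 2)) (2 * m + 2 * n - 2 * real i - 2 * real r + 3) /
         (q_Gamma (q powr (1 / 2)) (2 * n - 2 * real i + 2) *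
          q_Gamma (q powr (1 / 2)) (2 * m - 2 * real i + 2))))"

definition rhs_numerator_pole :: "nat \<Rightarrow> real \<Rightarrow> real \<Rightarrow> bool" where
  "rhs_numerator_pole r m n \<longleftrightarrow>
     (\<exists>i \<in> {1..r}. 2 * real i \<in> \<int>\<^sub>\<le>\<^sub>0 \<or> 2 * n + 1 \<in> \<int>\<^sub>\<le>\<^sub>0 \<or> 2 * m + 1 \<in> \<int>\<^sub>\<le>\<^sub>0 \<or>
        2 * m + 2 * n - 2 * real i - 2 * real r + 3 \<in> \<int>\<^sub>\<le>\<^sub>0)"

end

theory Submission
  imports Defs "Jordan_Normal_Form.Determinant"
begin

text \<open>
  Write \<open>x\<^sub>k = q\<^sup>k + q\<^sup>-\<^sup>k\<close>. Since \<open>(1 - q\<^sup>b\<^sup>-\<^sup>a) (1 - q\<^sup>a\<^sup>+\<^sup>b) = q\<^sup>b (x\<^sub>b - x\<^sub>a)\<close>, the pair product of the left-hand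
  side is a squared Vandermonde product in the \<open>x\<close>-variables, and the powers \<open>q\<^sup>b\<close> that are left over
  turn the index-dependent factors into one weight, the same for all variables and even in \<open>k\<close>
  (\<open>summand_eq\<close>). The sum is thus a discrete Selberg sum, and the identity of Andreief converts it into
  \<open>r!\<close> times an \<open>r \<times> r\<close> determinant of moments of that weight, with respect to any two polynomial bases.

  The bases are chosen to match the two \<open>q\<close>-binomial coefficients: the polynomial of degree \<open>i\<close> in \<open>x\<^sub>k\<close>
  whose factors are \<open>(1 - q\<^sup>n\<^sup>-\<^sup>k\<^sup>-\<^sup>l) (1 - q\<^sup>n\<^sup>+\<^sup>k\<^sup>-\<^sup>l)\<close> for \<open>l < i\<close> just lowers \<open>n\<close> to \<open>n - i\<close> in the first
  coefficient, and likewise for \<open>m\<close>. So the \<open>(i, j)\<close> moment is the one-variable sum with \<open>n - i\<close>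
  and \<open>m - j\<close> in place of \<open>n\<close> and \<open>m\<close>. This is a terminating very-well-poised \<open>6\<phi>5\<close> series, summed by
  telescoping in \<open>n\<close> (\<open>moment_sum\<close>); its value has the form \<open>f n * g m * h (n + m)\<close>. Hence the
  determinant is that of a Hankel matrix of quotients of shifted infinite products, which Gaussian
  elimination reduces to a smaller matrix of the same kind (\<open>det_euler_ratio\<close>).

  All of this is expressed by the entire function \<open>q_euler q x = (q\<^sup>x; q)\<^sub>\<infinity>\<close>, an elementary multiple of
  \<open>1 / \<Gamma>\<^sub>q(x)\<close>. Its zeros make both sides vanish when \<open>r\<close> exceeds the number of nonzero values of \<open>\<bar>k\<bar>\<close>,
  so no case distinction on \<open>r\<close> occurs. On the right-hand side the only numerator that can have a pole is
  \<open>\<Gamma>\<close> to the base \<open>\<surd>q\<close> at \<open>2 x - 1\<close> with \<open>x = m + n - i - r + 2\<close>. By the duplication formula its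
  quotient by \<open>\<Gamma>\<^sub>q(x)\<close> is a constant times \<open>\<Gamma>\<^sub>q(x - 1/2)\<close> (up to elementary powers), which is regular at integral \<open>x\<close>.
  The resulting expression \<open>selberg_value\<close> is continuous at \<open>(m, n)\<close>, which gives the limit in
  the pole case.
\<close>

hide_const (open) Determinants.det Finite_Cartesian_Product.mat

section \<open>The entire function \<open>(q\<^sup>x; q)\<^sub>\<infinity>\<close>\<close>

text \<open>
  Reciprocal of \<open>q_Gamma q x\<close> up to the factor \<open>(1 - q) powr (1 - x) * (q; q)\<^sub>\<infinity>\<close>; unlike the quotient it needs
  no convention at the poles, and it satisfies the recurrence \<open>q_euler_rec\<close> for every real \<open>x\<close>.
\<close>
definition q_euler :: "real \<Rightarrow> real \<Rightarrow> real" where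
  "q_euler q x = q_pochhammer_inf (q powr x) q"

context
  fixes q :: real
  assumes q: "0 < q" "q < 1"
begin

lemma pochhammer_partial_products:
  "convergent_prod (\<lambda>k. 1 - a * q ^ k)"
  "(\<lambda>n. \<Prod>k<n. 1 - a * q ^ k) \<longlonglongrightarrow> q_pochhammer_inf a q"
proof -
  have "summable (\<lambda>k. norm ((1 - a * q ^ k) - 1))"
    using q by (simp add: abs_mult summable_mult summable_geometric)
  then show c: "convergent_prod (\<lambda>k. 1 - a * q ^ k)"
    by (intro abs_convergent_prod_imp_convergent_prod summable_imp_abs_convergent_prod)
  show "(\<lambda>n. \<Prod>k<n. 1 - a * q ^ k) \<longlonglongrightarrow> q_pochhammer_inf a q"
    using convergent_prod_LIMSEQ[OF c]
    unfolding q_pochhammer_inf_def LIMSEQ_lessThan_iff_atMost .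
qed

lemma q_euler_LIMSEQ: "(\<lambda>n. \<Prod>k<n. 1 - q powr (x + real k)) \<longlonglongrightarrow> q_euler q x"
  using pochhammer_partial_products(2)[of "q powr x"] q
  by (simp add: q_euler_def powr_add powr_realpow)

lemma q_euler_rec: "q_euler q x = (1 - q powr x) * q_euler q (x + 1)"
proof -
  have "(\<lambda>n. \<Prod>k<Suc n. 1 - q powr (x + real k)) \<longlonglongrightarrow> q_euler q x"
    using q_euler_LIMSEQ LIMSEQ_Suc by blast
  moreover have "(\<Prod>k<Suc n. 1 - q powr (x + real k)) =
      (1 - q powr x) * (\<Prod>k<n. 1 - q powr (x + 1 + real k))" for n
    by (subst prod.lessThan_Suc_shift) (simp add: add_ac)
  ultimately show ?thesis
    using tendsto_mult_left[OF q_euler_LIMSEQ[of "x + 1"], of "1 - q powr x"] LIMSEQ_unique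
    by simp
qed

lemma q_euler_eq_0_iff: "q_euler q x = 0 \<longleftrightarrow> x \<in> \<int>\<^sub>\<le>\<^sub>0"
proof
  assume "q_euler q x = 0"
  then obtain k where "1 - q powr x * q ^ k = 0"
    using prodinf_nonzero[OF pochhammer_partial_products(1)]
    unfolding q_euler_def q_pochhammer_inf_def by blast
  then have "q powr (x + real k) = 1"
    using q by (simp add: powr_add powr_realpow)
  then have "x = - real k"
    using q by (simp add: powr_eq_one_iff_gen)
  then show "x \<in> \<int>\<^sub>\<le>\<^sub>0"
    by simp
next
  have zero: "q_euler q (- real n) = 0" for n
  proof (induction n)
    case 0
    then show ?case using q_euler_rec[of 0] q by simp
  next
    case (Suc n)
    then show ?case using q_euler_rec[of "- real (Suc n)"] by simp
  qed
  assume "x \<in> \<int>\<^sub>\<le>\<^sub>0"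
  then show "q_euler q x = 0"
    by (auto elim!: nonpos_Ints_cases' simp: zero)
qed

lemma q_euler_pos_nonzero: "x > 0 \<Longrightarrow> q_euler q x \<noteq> 0"
  by (auto simp: q_euler_eq_0_iff elim!: nonpos_Ints_cases)

text \<open>
  The partial products converge uniformly near \<open>x\<close>, by comparison with a geometric series.
\<close>
lemma isCont_q_euler: "isCont (q_euler q) x"
proof -
  define A where "A = {x - 1..x + 1}"
  have "uniformly_convergent_on A (\<lambda>N y. \<Prod>k<N. 1 + (- (q powr (y + real k))))"
  proof (rule uniformly_convergent_on_prod)
    show "continuous_on A (\<lambda>y. - (q powr (y + real k)))" for k
      using q by (intro continuous_intros) auto
    show "compact A"
      by (simp add: A_def)
    have "norm (norm (- (q powr (y + real k)))) \<le> q powr (x - 1) * q ^ k" if "y \<in> A" for y k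
    proof -
      have "q powr y \<le> q powr (x - 1)"
        using that q by (intro powr_mono') (auto simp: A_def)
      then show ?thesis
        using q by (simp add: powr_add powr_realpow mult_right_mono)
    qed
    moreover have "summable (\<lambda>k. q powr (x - 1) * q ^ k)"
      using q by (intro summable_mult summable_geometric) auto
    ultimately show "uniformly_convergent_on A (\<lambda>N y. \<Sum>k<N. norm (- (q powr (y + real k))))"
      by (rule Weierstrass_m_test')
  qed
  then have "uniformly_convergent_on A (\<lambda>N y. \<Prod>k<N. 1 - q powr (y + real k))"
    by simp
  then obtain g where g: "uniform_limit A (\<lambda>N y. \<Prod>k<N. 1 - q powr (y + real k)) g sequentially"
    unfolding uniformly_convergent_on_def by blast
  have "continuous_on A g"
    using q by (intro uniform_limit_theorem[OF _ g] always_eventually allI continuous_intros) auto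
  moreover have "g y = q_euler q y" if "y \<in> A" for y
    using LIMSEQ_unique[OF tendsto_uniform_limitI[OF g that] q_euler_LIMSEQ] .
  ultimately have "continuous_on A (q_euler q)"
    using continuous_on_cong by metis
  then show ?thesis
    by (rule continuous_on_interior) (simp add: A_def)
qed

end

text \<open>
  The factors with even and with odd index of the product to base \<open>\<surd>q\<close> form two products to base \<open>q\<close>.
  This is the \<open>q\<close>-analogue of Legendre's duplication formula.
\<close>
lemma q_euler_duplication:
  assumes q: "0 < q" "q < 1"
  shows "q_euler (sqrt q) (2 * x) = q_euler q x * q_euler q (x + 1 / 2)"
proof -
  have s: "sqrt q powr y = q powr (y / 2)" for y
    using q by (simp add: powr_half_sqrt[symmetric] powr_powr)
  have split: "(\<Prod>k<2 * n. 1 - sqrt q powr (2 * x + real k)) =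
      (\<Prod>k<n. 1 - q powr (x + real k)) * (\<Prod>k<n. 1 - q powr (x + 1 / 2 + real k))" for n
    by (induction n) (simp_all add: s add_divide_distrib add_ac)
  have "(\<lambda>n. \<Prod>k<2 * n. 1 - sqrt q powr (2 * x + real k)) \<longlonglongrightarrow> q_euler (sqrt q) (2 * x)"
    using LIMSEQ_subseq_LIMSEQ[OF q_euler_LIMSEQ[of "sqrt q" "2 * x"], of "\<lambda>n. 2 * n"] q
    by (simp add: strict_mono_def o_def)
  moreover have "(\<lambda>n. \<Prod>k<2 * n. 1 - sqrt q powr (2 * x + real k)) \<longlonglongrightarrow>
      q_euler q x * q_euler q (x + 1 / 2)"
    unfolding split using q by (intro tendsto_mult q_euler_LIMSEQ) auto
  ultimately show ?thesis
    by (rule LIMSEQ_unique)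
qed

section \<open>The one-variable sum\<close>

text \<open>
  The summand of the one-variable sum at \<open>k > 0\<close>, up to a factor independent of \<open>k\<close>: each \<open>q\<close>-binomial
  coefficient is written as a product of two \<open>q_euler\<close> values. These vanish outside the summation range, so
  sums may be extended freely.
\<close>
definition moment_term :: "real \<Rightarrow> real \<Rightarrow> real \<Rightarrow> real \<Rightarrow> real" where
  "moment_term q \<nu> \<mu> k =
     q powr (k\<^sup>2 - 3 / 2 * k) * (1 - q powr (2 * k)) * (1 - q powr k) *
     (q_euler q (\<nu> + k + 1) * q_euler q (\<nu> - k + 1) *
      (q_euler q (\<mu> + k + 1) * q_euler q (\<mu> - k + 1)))"

text \<open>
  The antidifference that proves the recurrence in \<open>\<nu>\<close>. Its factors \<open>1 - q powr (k - 1)\<close> and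
  \<open>1 - q powr (k - 1 / 2)\<close> make it vanish at the lower end \<open>k = 1\<close> of the integral and \<open>k = 1 / 2\<close> of the
  half-integral range, which is why one proof covers both.
\<close>
definition moment_certificate :: "real \<Rightarrow> real \<Rightarrow> real \<Rightarrow> real \<Rightarrow> real" where
  "moment_certificate q \<nu> \<mu> k =
     - (q powr (\<nu> + 1 - k) * (1 - q powr (k - 1)) * (1 - q powr (k - 1 / 2)) * (1 - q powr k) *
        q powr (k\<^sup>2 - 3 / 2 * k) *
        (q_euler q (\<nu> + k + 1) * q_euler q (\<nu> - k + 2) *
         (q_euler q (\<mu> + k) * q_euler q (\<mu> - k + 1))))"

definition moment_value :: "real \<Rightarrow> real \<Rightarrow> real \<Rightarrow> real" where
  "moment_value q \<nu> \<mu> =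
     q powr (- (1 / 2)) * (1 - sqrt q) * (q_euler q 1)\<^sup>2 / q_euler (sqrt q) 1 *
     (q_euler (sqrt q) (2 * \<nu>) * q_euler (sqrt q) (2 * \<mu>)) *
     (q_euler q (\<nu> + \<mu> + 1) / q_euler q (\<nu> + \<mu> - 1 / 2))"

text \<open>
  The telescoping relation divided by all common factors, with \<open>z = q\<^sup>k\<close>, \<open>u = q\<^sup>\<nu>\<close>, \<open>v = q\<^sup>\<mu>\<close>
  and \<open>p = \<surd>q\<close>.
\<close>
lemma telescoping_identity:
  fixes u v z p :: real
  assumes "z \<noteq> 0" "p \<noteq> 0"
  shows "(1 - u) * (1 - u * p) * (1 - u * v * p\<^sup>2) * (1 - z\<^sup>2) -
         (1 - u * v / p) * (1 - z\<^sup>2) * (1 - u * p\<^sup>2 * z) * (1 - u * p\<^sup>2 / z) =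
         (u * p\<^sup>2 / z) * (1 - z / p\<^sup>2) * (1 - z / p) * (1 - u * z * p\<^sup>2) * (1 - v * z) -
         (u * p\<^sup>2 / z) * (1 - z * p) * (1 - p\<^sup>2 * z) * (z - u * p\<^sup>2) * (z - v) / p ^ 3"
proof -
  have over: "P - Q / w = R / w - S / w" if "P * w - Q = R - S" "w \<noteq> 0" for P Q R S w :: real
    using that by (simp add: field_simps)
  have "(1 - u) * (1 - u * p) * (1 - u * v * p\<^sup>2) * (1 - z\<^sup>2) * (p * z) -
        (p - u * v) * (1 - z\<^sup>2) * (1 - u * p\<^sup>2 * z) * (z - u * p\<^sup>2) =
        u * (p\<^sup>2 - z) * (p - z) * (1 - u * z * p\<^sup>2) * (1 - v * z) -
        u * (1 - z * p) * (1 - p\<^sup>2 * z) * (z - u * p\<^sup>2) * (z - v)"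
    by (simp add: algebra_simps power2_eq_square)
  moreover have "(1 - u * v / p) * (1 - z\<^sup>2) * (1 - u * p\<^sup>2 * z) * (1 - u * p\<^sup>2 / z) =
        (p - u * v) * (1 - z\<^sup>2) * (1 - u * p\<^sup>2 * z) * (z - u * p\<^sup>2) / (p * z)"
    "(u * p\<^sup>2 / z) * (1 - z * p) * (1 - p\<^sup>2 * z) * (z - u * p\<^sup>2) * (z - v) / p ^ 3 =
        u * (1 - z * p) * (1 - p\<^sup>2 * z) * (z - u * p\<^sup>2) * (z - v) / (p * z)"
    "(u * p\<^sup>2 / z) * (1 - z / p\<^sup>2) * (1 - z / p) * (1 - u * z * p\<^sup>2) * (1 - v * z) =
        u * (p\<^sup>2 - z) * (p - z) * (1 - u * z * p\<^sup>2) * (1 - v * z) / (p * z)"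
    using assms by (simp_all add: divide_simps power2_eq_square power3_eq_cube mult_ac)
  ultimately show ?thesis
    using assms by (simp only:) (rule over, simp_all)
qed

context
  fixes q :: real
  assumes q: "0 < q" "q < 1"
begin

lemma moment_term_telescopes:
  "(1 - q powr \<nu>) * (1 - q powr (\<nu> + 1 / 2)) * (1 - q powr (\<nu> + \<mu> + 1)) * moment_term q (\<nu> + 1) \<mu> k -
     (1 - q powr (\<nu> + \<mu> - 1 / 2)) * moment_term q \<nu> \<mu> k =
   moment_certificate q \<nu> \<mu> (k + 1) - moment_certificate q \<nu> \<mu> k"
proof -
  define z u v p where "z = q powr k" and "u = q powr \<nu>" and "v = q powr \<mu>" and "p = q powr (1 / 2)"
  define W where "W = q powr (k\<^sup>2 - 3 / 2 * k)"
  define e1 e2 e3 e4 where "e1 = q_euler q (\<nu> + k + 2)" and "e2 = q_euler q (\<nu> - k + 2)"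
    and "e3 = q_euler q (\<mu> + k + 1)" and "e4 = q_euler q (\<mu> - k + 1)"
  have nz: "z \<noteq> 0" "p \<noteq> 0" "u \<noteq> 0" "v \<noteq> 0"
    using q by (auto simp: z_def p_def u_def v_def)
  have qp: "q = p\<^sup>2"
    using q by (simp add: p_def power2_eq_square flip: powr_add)
  have half: "q powr (x + 1 / 2) = q powr x * p" "q powr (x - 1 / 2) = q powr x / p"
    "q powr (x + 1) = q powr x * p\<^sup>2" "q powr (x - 1) = q powr x / p\<^sup>2" for x
    using q by (simp_all add: p_def powr_add powr_diff flip: qp[unfolded p_def])
  have powrs: "q powr (\<nu> + 1 / 2) = u * p" "q powr (\<nu> + \<mu> + 1) = u * v * p\<^sup>2"
    "q powr (\<nu> + \<mu> - 1 / 2) = u * v / p" "q powr (2 * k) = z\<^sup>2"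
    "q powr (\<nu> + 1 - k) = u * p\<^sup>2 / z" "q powr (\<nu> + 1 - (k + 1)) = u / z"
    "q powr (k - 1) = z / p\<^sup>2" "q powr (k - 1 / 2) = z / p"
    "q powr (k + 1 - 1) = z" "q powr (k + 1 - 1 / 2) = z * p" "q powr (k + 1) = z * p\<^sup>2"
    "q powr (\<nu> + k + 1) = u * z * p\<^sup>2" "q powr (\<nu> - k + 1) = u * p\<^sup>2 / z"
    "q powr (\<mu> + k) = v * z" "q powr (\<mu> - k) = v / z"
    "q powr ((k + 1)\<^sup>2 - 3 / 2 * (k + 1)) = W * z\<^sup>2 / p"
  proof -
    have sq: "q powr (2 * k) = z\<^sup>2"
      using q by (simp add: z_def power2_eq_square flip: powr_add)
    have "(k + 1)\<^sup>2 - 3 / 2 * (k + 1) = (k\<^sup>2 - 3 / 2 * k + 2 * k) - 1 / 2"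
      by (simp add: power2_eq_square field_simps)
    then show "q powr ((k + 1)\<^sup>2 - 3 / 2 * (k + 1)) = W * z\<^sup>2 / p"
      by (simp only: half(2) powr_add sq W_def)
    show "q powr (2 * k) = z\<^sup>2" by (fact sq)
    have "\<nu> + 1 - k = \<nu> - k + 1" "\<nu> + 1 - (k + 1) = \<nu> - k" "k + 1 - 1 / 2 = k + 1 / 2"
      by simp_all
    then show "q powr (\<nu> + 1 - k) = u * p\<^sup>2 / z" "q powr (\<nu> + 1 - (k + 1)) = u / z"
      "q powr (k + 1 - 1 / 2) = z * p"
      by (simp_all only: half) (simp_all add: powr_diff u_def z_def)
  qed (simp_all only: half, simp_all only: powr_add powr_diff u_def v_def z_def, simp_all add: nz)
  have recs: "q_euler q (\<nu> + k + 1) = (1 - u * z * p\<^sup>2) * e1"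
    "q_euler q (\<nu> - k + 1) = (1 - u * p\<^sup>2 / z) * e2"
    "q_euler q (\<mu> + k) = (1 - v * z) * e3" "q_euler q (\<mu> - k) = (1 - v / z) * e4"
  proof -
    have two: "\<nu> + k + 1 + 1 = \<nu> + k + 2" "\<nu> - k + 1 + 1 = \<nu> - k + 2"
      by simp_all
    show "q_euler q (\<nu> + k + 1) = (1 - u * z * p\<^sup>2) * e1"
      "q_euler q (\<nu> - k + 1) = (1 - u * p\<^sup>2 / z) * e2"
      "q_euler q (\<mu> + k) = (1 - v * z) * e3" "q_euler q (\<mu> - k) = (1 - v / z) * e4"
      using q_euler_rec[OF q, of "\<nu> + k + 1"] q_euler_rec[OF q, of "\<nu> - k + 1"]
        q_euler_rec[OF q, of "\<mu> + k"] q_euler_rec[OF q, of "\<mu> - k"]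
      unfolding two powrs e1_def e2_def e3_def e4_def .
  qed
  have shifts: "q_euler q (\<nu> + 1 + k + 1) = e1" "q_euler q (\<nu> + 1 - k + 1) = e2"
    "q_euler q (\<nu> + (k + 1) + 1) = e1" "q_euler q (\<nu> - (k + 1) + 2) = q_euler q (\<nu> - k + 1)"
    "q_euler q (\<mu> + (k + 1)) = e3" "q_euler q (\<mu> - (k + 1) + 1) = q_euler q (\<mu> - k)"
    by (simp_all add: e1_def e2_def e3_def algebra_simps)
  have T1: "moment_term q (\<nu> + 1) \<mu> k = W * (1 - z\<^sup>2) * (1 - z) * (e1 * e2 * (e3 * e4))"
    unfolding moment_term_def shifts powrs W_def[symmetric] z_def[symmetric] e3_def[symmetric] e4_def[symmetric] ..
  have T0: "moment_term q \<nu> \<mu> k = W * (1 - z\<^sup>2) * (1 - z) *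
      ((1 - u * z * p\<^sup>2) * e1 * ((1 - u * p\<^sup>2 / z) * e2) * (e3 * e4))"
    unfolding moment_term_def recs powrs W_def[symmetric] z_def[symmetric] e3_def[symmetric] e4_def[symmetric] ..
  have G1: "moment_certificate q \<nu> \<mu> (k + 1) = - (u / z * (1 - z) * (1 - z * p) * (1 - z * p\<^sup>2) *
      (W * z\<^sup>2 / p) * (e1 * ((1 - u * p\<^sup>2 / z) * e2) * (e3 * ((1 - v / z) * e4))))"
    unfolding moment_certificate_def shifts recs powrs ..
  have G0: "moment_certificate q \<nu> \<mu> k = - (u * p\<^sup>2 / z * (1 - z / p\<^sup>2) * (1 - z / p) * (1 - z) *
      W * ((1 - u * z * p\<^sup>2) * e1 * e2 * ((1 - v * z) * e3 * e4)))"
    unfolding moment_certificate_def recs powrs W_def[symmetric] z_def[symmetric] e2_def[symmetric] e4_def[symmetric] ..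
  have "(1 - u) * (1 - u * p) * (1 - u * v * p\<^sup>2) * moment_term q (\<nu> + 1) \<mu> k -
      (1 - u * v / p) * moment_term q \<nu> \<mu> k =
      W * (1 - z) * (e1 * e2 * e3 * e4) * ((1 - u) * (1 - u * p) * (1 - u * v * p\<^sup>2) * (1 - z\<^sup>2) -
         (1 - u * v / p) * (1 - z\<^sup>2) * (1 - u * p\<^sup>2 * z) * (1 - u * p\<^sup>2 / z))"
  proof -
    have "(1 - u) * (1 - u * p) * (1 - u * v * p\<^sup>2) * moment_term q (\<nu> + 1) \<mu> k =
        W * (1 - z) * (e1 * e2 * e3 * e4) * ((1 - u) * (1 - u * p) * (1 - u * v * p\<^sup>2) * (1 - z\<^sup>2))"
      unfolding T1 by (simp only: mult_ac)
    moreover have "(1 - u * v / p) * moment_term q \<nu> \<mu> k =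
        W * (1 - z) * (e1 * e2 * e3 * e4) *
          ((1 - u * v / p) * (1 - z\<^sup>2) * (1 - u * p\<^sup>2 * z) * (1 - u * p\<^sup>2 / z))"
      unfolding T0 by (simp only: mult_ac)
    ultimately show ?thesis
      by (simp only: right_diff_distrib[of "W * (1 - z) * (e1 * e2 * e3 * e4)"])
  qed
  also have "\<dots> = W * (1 - z) * (e1 * e2 * e3 * e4) *
        ((u * p\<^sup>2 / z) * (1 - z / p\<^sup>2) * (1 - z / p) * (1 - u * z * p\<^sup>2) * (1 - v * z) -
         (u * p\<^sup>2 / z) * (1 - z * p) * (1 - p\<^sup>2 * z) * (z - u * p\<^sup>2) * (z - v) / p ^ 3)"
    by (simp only: telescoping_identity[OF nz(1,2)])
  also have "\<dots> = moment_certificate q \<nu> \<mu> (k + 1) - moment_certificate q \<nu> \<mu> k"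
  proof -
    have "(u * p\<^sup>2 / z) * (1 - z * p) * (1 - p\<^sup>2 * z) * (z - u * p\<^sup>2) * (z - v) / p ^ 3 =
      u / z * (1 - z * p) * (1 - z * p\<^sup>2) * (z\<^sup>2 / p) * ((1 - u * p\<^sup>2 / z) * (1 - v / z))"
      using nz by (simp add: divide_simps power2_eq_square power3_eq_cube mult_ac)
    then have "W * (1 - z) * (e1 * e2 * e3 * e4) *
        ((u * p\<^sup>2 / z) * (1 - z * p) * (1 - p\<^sup>2 * z) * (z - u * p\<^sup>2) * (z - v) / p ^ 3) =
        - moment_certificate q \<nu> \<mu> (k + 1)"
      unfolding G1 by (simp only: minus_minus mult_ac times_divide_eq_right[symmetric])
    moreover have "W * (1 - z) * (e1 * e2 * e3 * e4) *
        ((u * p\<^sup>2 / z) * (1 - z / p\<^sup>2) * (1 - z / p) * (1 - u * z * p\<^sup>2) * (1 - v * z)) =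
        - moment_certificate q \<nu> \<mu> k"
      unfolding G0 by (simp only: minus_minus mult_ac)
    ultimately show ?thesis
      by (simp only: right_diff_distrib minus_diff_eq diff_minus_eq_add uminus_add_conv_diff)
  qed
  finally show ?thesis
    by (simp only: powrs u_def)
qed

text \<open>
  The closed form satisfies the recurrence in \<open>\<nu>\<close> that \<open>moment_term_telescopes\<close> yields for the sum. The
  hypothesis keeps the denominator of \<open>moment_value\<close> away from its zeros.
\<close>
lemma moment_value_step:
  "(1 - q powr \<nu>) * (1 - q powr (\<nu> + 1 / 2)) * (1 - q powr (\<nu> + \<mu> + 1)) * moment_value q (\<nu> + 1) \<mu> =
   (1 - q powr (\<nu> + \<mu> - 1 / 2)) * moment_value q \<nu> \<mu>"
  if "\<nu> + \<mu> > 1 / 2"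
proof -
  have s: "sqrt q powr y = q powr (y / 2)" for y
    using q by (simp add: powr_half_sqrt[symmetric] powr_powr)
  have sq: "0 < sqrt q" "sqrt q < 1"
    using q by auto
  have "q_euler (sqrt q) (2 * \<nu>) =
      (1 - q powr \<nu>) * ((1 - q powr (\<nu> + 1 / 2)) * q_euler (sqrt q) (2 * (\<nu> + 1)))"
  proof -
    have "2 * (\<nu> + 1) = 2 * \<nu> + 1 + 1" "2 * \<nu> / 2 = \<nu>" "(2 * \<nu> + 1) / 2 = \<nu> + 1 / 2"
      by simp_all
    then show ?thesis
      using q_euler_rec[OF sq, of "2 * \<nu>"] q_euler_rec[OF sq, of "2 * \<nu> + 1"]
      by (simp only: s)
  qed
  moreover have "q_euler q (\<nu> + \<mu> + 1) = (1 - q powr (\<nu> + \<mu> + 1)) * q_euler q (\<nu> + 1 + \<mu> + 1)"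
    using q_euler_rec[OF q, of "\<nu> + \<mu> + 1"] by (simp add: add_ac)
  moreover have "q_euler q (\<nu> + \<mu> - 1 / 2) =
      (1 - q powr (\<nu> + \<mu> - 1 / 2)) * q_euler q (\<nu> + 1 + \<mu> - 1 / 2)"
    using q_euler_rec[OF q, of "\<nu> + \<mu> - 1 / 2"] by (simp add: algebra_simps)
  moreover have "1 - q powr (\<nu> + \<mu> - 1 / 2) \<noteq> 0"
    using q that powr_eq_one_iff_gen[of q] by auto
  ultimately show ?thesis
    unfolding moment_value_def by simp
qed

lemma moment_term_eq_0_beyond:
  assumes "\<nu> - k + 1 \<in> \<int>\<^sub>\<le>\<^sub>0 \<or> \<mu> - k + 1 \<in> \<int>\<^sub>\<le>\<^sub>0"
  shows "moment_term q \<nu> \<mu> k = 0"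
  using assms by (auto simp: moment_term_def q_euler_eq_0_iff[OF q])

text \<open>
  For the smallest \<open>\<nu>\<close> only the term \<open>k = \<nu>\<close> of the sum survives.
\<close>
lemma moment_sum_base:
  assumes k0: "k0 = 1 / 2 \<or> k0 = 1" and "\<mu> > 0"
  shows "moment_term q k0 \<mu> k0 = moment_value q k0 \<mu>"
proof -
  have sq: "0 < sqrt q" "sqrt q < 1"
    using q by auto
  have dup: "q_euler (sqrt q) (2 * \<mu>) = q_euler q \<mu> * q_euler q (\<mu> + 1 / 2)"
    by (rule q_euler_duplication[OF q])
  have nz: "q_euler (sqrt q) 1 \<noteq> 0" "q_euler q 1 \<noteq> 0" "q_euler q \<mu> \<noteq> 0" "q_euler q (\<mu> + 1 / 2) \<noteq> 0"
    using q_euler_pos_nonzero[OF q] q_euler_pos_nonzero[OF sq] \<open>\<mu> > 0\<close> by auto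
  have half: "q powr (1 / 2) = sqrt q"
    using q by (simp add: powr_half_sqrt)
  have r1: "q_euler q 1 = (1 - q) * q_euler q 2" "q_euler q 2 = (1 - q\<^sup>2) * q_euler q 3"
    "q_euler (sqrt q) 1 = (1 - sqrt q) * q_euler (sqrt q) 2"
    using q_euler_rec[OF q, of 1] q_euler_rec[OF q, of 2] q_euler_rec[OF sq, of 1] q by simp_all
  have p1: "sqrt q \<noteq> 1" using sq by auto
  from k0 show ?thesis
  proof
    assume [simp]: "k0 = 1 / 2"
    have "moment_term q k0 \<mu> k0 =
        q powr (- (1 / 2)) * (1 - q) * (1 - sqrt q) * (q_euler q 2 * q_euler q 1 *
          (q_euler q (\<mu> + 3 / 2) * q_euler q (\<mu> + 1 / 2)))"
      using q by (simp add: moment_term_def half power2_eq_square add_ac)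
    moreover have "moment_value q k0 \<mu> = q powr (- (1 / 2)) * (1 - sqrt q) * (q_euler q 1)\<^sup>2 *
         (q_euler q (\<mu> + 1 / 2) * q_euler q (\<mu> + 3 / 2))"
      using nz by (simp add: moment_value_def dup add_ac)
    ultimately show ?thesis
      by (simp add: power2_eq_square r1(1))
  next
    assume [simp]: "k0 = 1"
    have "moment_term q k0 \<mu> k0 =
        q powr (- (1 / 2)) * (1 - q\<^sup>2) * (1 - q) * (q_euler q 3 * q_euler q 1 *
          (q_euler q (\<mu> + 2) * q_euler q \<mu>))"
      using q by (simp add: moment_term_def add_ac)
    moreover have "moment_value q k0 \<mu> = q powr (- (1 / 2)) * (q_euler q 1)\<^sup>2 *
         (q_euler q \<mu> * q_euler q (\<mu> + 2))"
      using nz p1 by (simp add: moment_value_def dup r1(3) add_ac)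
    ultimately show ?thesis
      by (simp add: power2_eq_square r1(1) r1(2))
  qed
qed

text \<open>
  Induction on \<open>a\<close>: both boundary terms of the telescoping sum vanish, the lower one by the choice of
  \<open>k0\<close> and the upper one because \<open>k\<close> has passed \<open>\<nu> + 1\<close>.
\<close>
lemma moment_sum_pos:
  assumes k0: "k0 = 1 / 2 \<or> k0 = 1" and "\<mu> > 0" and "a < J"
  shows "(\<Sum>j<J. moment_term q (k0 + real a) \<mu> (k0 + real j)) = moment_value q (k0 + real a) \<mu>"
  using \<open>a < J\<close>
proof (induction a)
  case 0
  have "moment_term q k0 \<mu> (k0 + real j) = 0" if "j > 0" for j
    using that by (intro moment_term_eq_0_beyond) (cases j; simp)
  then have "(\<Sum>j<J. moment_term q k0 \<mu> (k0 + real j)) = (\<Sum>j\<in>{0}. moment_term q k0 \<mu> (k0 + real j))"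
    using 0 by (intro sum.mono_neutral_right) auto
  then show ?case
    using moment_sum_base[OF k0 \<open>\<mu> > 0\<close>] by simp
next
  case (Suc a)
  define \<nu> where "\<nu> = k0 + real a"
  define c where "c = (1 - q powr \<nu>) * (1 - q powr (\<nu> + 1 / 2)) * (1 - q powr (\<nu> + \<mu> + 1))"
  define d where "d = 1 - q powr (\<nu> + \<mu> - 1 / 2)"
  have \<nu>: "\<nu> \<ge> 1 / 2"
    using k0 by (auto simp: \<nu>_def)
  have "moment_certificate q \<nu> \<mu> k0 = 0"
    using k0 q by (auto simp: moment_certificate_def)
  moreover have "\<nu> - (k0 + real J) + 2 \<in> \<int>\<^sub>\<le>\<^sub>0"
  proof -
    have "\<nu> - (k0 + real J) + 2 = - real (J - a - 2)"
      using Suc.prems by (simp add: \<nu>_def of_nat_diff)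
    then show ?thesis by simp
  qed
  then have "moment_certificate q \<nu> \<mu> (k0 + real J) = 0"
    by (simp add: moment_certificate_def q_euler_eq_0_iff[OF q])
  moreover have "(\<Sum>j<J. moment_certificate q \<nu> \<mu> (k0 + real (Suc j)) - moment_certificate q \<nu> \<mu> (k0 + real j)) =
      moment_certificate q \<nu> \<mu> (k0 + real J) - moment_certificate q \<nu> \<mu> (k0 + real 0)"
    by (rule sum_lessThan_telescope)
  ultimately have "(\<Sum>j<J. c * moment_term q (\<nu> + 1) \<mu> (k0 + real j) - d * moment_term q \<nu> \<mu> (k0 + real j)) = 0"
    using moment_term_telescopes[of \<nu> \<mu>] unfolding c_def d_def by (simp add: add_ac)
  then have "c * (\<Sum>j<J. moment_term q (\<nu> + 1) \<mu> (k0 + real j)) =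
      d * (\<Sum>j<J. moment_term q \<nu> \<mu> (k0 + real j))"
    by (simp add: sum_subtractf sum_distrib_left)
  also have "\<dots> = d * moment_value q \<nu> \<mu>"
    using Suc by (simp add: \<nu>_def)
  also have "\<dots> = c * moment_value q (\<nu> + 1) \<mu>"
    using moment_value_step[of \<nu> \<mu>] \<nu> \<open>\<mu> > 0\<close> by (simp add: c_def d_def)
  finally have "c * (\<Sum>j<J. moment_term q (\<nu> + 1) \<mu> (k0 + real j)) = c * moment_value q (\<nu> + 1) \<mu>" .
  moreover have "c \<noteq> 0"
    using \<nu> \<open>\<mu> > 0\<close> q powr_eq_one_iff_gen[of q] by (auto simp: c_def)
  ultimately show ?case
    by (simp add: \<nu>_def add_ac)
qed

text \<open>
  If \<open>\<nu> \<le> 0\<close> or \<open>\<mu> \<le> 0\<close> both sides are zero. These degenerate entries occur in the moment matrix when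
  \<open>r\<close> is large compared with \<open>n\<close> or \<open>m\<close>.
\<close>
lemma moment_sum:
  assumes k0: "k0 = 1 / 2 \<or> k0 = 1" and "\<nu> - k0 \<in> \<int>" "\<mu> - k0 \<in> \<int>" and J: "\<nu> < k0 + real J"
  shows "(\<Sum>j<J. moment_term q \<nu> \<mu> (k0 + real j)) = moment_value q \<nu> \<mu>"
proof (cases "\<nu> > 0 \<and> \<mu> > 0")
  case True
  from assms(2) obtain i where i: "\<nu> - k0 = of_int i"
    by (auto elim: Ints_cases)
  have "real_of_int i > -1"
    using i True k0 by auto
  then have "i \<ge> 0"
    by linarith
  then have "\<nu> = k0 + real (nat i)"
    using i by simp
  moreover from this have "nat i < J"
    using J by simp
  ultimately show ?thesis
    using moment_sum_pos[OF k0, of \<mu> "nat i" J] True by simp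
next
  case False
  have neg: "x - (k0 + real j) + 1 \<in> \<int>\<^sub>\<le>\<^sub>0 \<and> 2 * x \<in> \<int>\<^sub>\<le>\<^sub>0" if "x \<le> 0" "x - k0 \<in> \<int>" for x j
  proof -
    obtain i where i: "x = k0 + of_int i"
      using \<open>x - k0 \<in> \<int>\<close> by (metis Ints_cases add.commute diff_add_cancel)
    have "real_of_int i < 0"
      using that i k0 by linarith
    then have "i < 0"
      by simp
    then have 1: "x - (k0 + real j) + 1 = of_int (i - int j + 1)" "i - int j + 1 \<le> 0"
      using i by simp_all
    moreover have "2 * x = of_int (2 * i + (if k0 = 1 then 2 else 1))"
      "2 * i + (if k0 = 1 then 2 else 1) \<le> 0"
      using i k0 \<open>i < 0\<close> by auto
    ultimately show ?thesis
      by (metis nonpos_Ints_of_int)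
  qed
  have sq: "0 < sqrt q" "sqrt q < 1"
    using q by auto
  have "moment_term q \<nu> \<mu> (k0 + real j) = 0" for j
    using False neg assms by (intro moment_term_eq_0_beyond) (auto simp: not_less)
  moreover have "q_euler (sqrt q) (2 * \<nu>) * q_euler (sqrt q) (2 * \<mu>) = 0"
    using False neg assms by (auto simp: q_euler_eq_0_iff[OF sq] not_less)
  ultimately show ?thesis
    by (simp add: moment_value_def)
qed

end

section \<open>Determinants\<close>

abbreviation fdet :: "nat \<Rightarrow> (nat \<Rightarrow> nat \<Rightarrow> real) \<Rightarrow> real" where
  "fdet r f \<equiv> Determinant.det (Matrix.mat r r (\<lambda>(i, j). f i j))"

lemma fdet_leibniz:
  "fdet r f = (\<Sum>p | p permutes {0..<r}. signof p * (\<Prod>i = 0..<r. f i (p i)))"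
proof -
  have "(\<Prod>i = 0..<r. Matrix.mat r r (\<lambda>(i, j). f i j) $$ (i, p i)) = (\<Prod>i = 0..<r. f i (p i))"
    if "p permutes {0..<r}" for p
    using that by (intro prod.cong) (auto simp: permutes_in_image)
  then show ?thesis
    by (simp add: det_def'[of _ r])
qed

lemma fdet_permute_rows:
  assumes "p permutes {0..<r}"
  shows "fdet r (\<lambda>i j. f (p i) j) = signof p * fdet r f"
proof -
  have "Matrix.mat r r (\<lambda>(i, j). f (p i) j) =
      Matrix.mat r r (\<lambda>(i, j). Matrix.mat r r (\<lambda>(i, j). f i j) $$ (p i, j))"
    using assms permutes_in_image[OF assms] by (intro eq_matI) auto
  then show ?thesis
    using det_permute_rows[OF _ assms, of "Matrix.mat r r (\<lambda>(i, j). f i j)"] by simp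
qed

lemma fdet_scale:
  "fdet r (\<lambda>i j. a i * b j * f i j) = (\<Prod>i<r. a i) * (\<Prod>j<r. b j) * fdet r f"
proof -
  have "(\<Prod>i = 0..<r. a i * b (p i) * f i (p i)) =
      (\<Prod>i<r. a i) * (\<Prod>j<r. b j) * (\<Prod>i = 0..<r. f i (p i))" if "p permutes {0..<r}" for p
    using prod.permute[OF that, of b] by (simp add: prod.distrib o_def atLeast0LessThan)
  then show ?thesis
    unfolding fdet_leibniz by (simp add: sum_distrib_left algebra_simps)
qed

lemma fdet_mult:
  "fdet r f * fdet r g = fdet r (\<lambda>i j. \<Sum>l<r. f i l * g l j)"
proof -
  have "Matrix.mat r r (\<lambda>(i, j). f i j) * Matrix.mat r r (\<lambda>(i, j). g i j) =
      Matrix.mat r r (\<lambda>(i, j). \<Sum>l<r. f i l * g l j)"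
    by (intro eq_matI) (auto simp: scalar_prod_def atLeast0LessThan)
  then show ?thesis
    by (metis det_mult mat_carrier)
qed

lemma fdet_lower_triangular:
  assumes "\<And>i j. i < j \<Longrightarrow> j < r \<Longrightarrow> f i j = 0"
  shows "fdet r f = (\<Prod>i<r. f i i)"
  using det_lower_triangular[of r "Matrix.mat r r (\<lambda>(i, j). f i j)"] assms
  by (simp add: prod_list_diag_prod atLeast0LessThan)

lemma fdet_transpose: "fdet r (\<lambda>i j. f j i) = fdet r f"
proof -
  have "transpose_mat (Matrix.mat r r (\<lambda>(i, j). f i j)) = Matrix.mat r r (\<lambda>(i, j). f j i)"
    by (intro eq_matI) auto
  then show ?thesis
    by (metis det_transpose mat_carrier)
qed

lemma fdet_first_column_0:
  assumes "\<And>i. i < r \<Longrightarrow> f (Suc i) 0 = 0"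
  shows "fdet (Suc r) f = f 0 0 * fdet r (\<lambda>i j. f (Suc i) (Suc j))"
proof -
  have "Matrix.mat (Suc r) (Suc r) (\<lambda>(i, j). f i j) =
      four_block_mat (Matrix.mat 1 1 (\<lambda>(i, j). f 0 0)) (Matrix.mat 1 r (\<lambda>(i, j). f 0 (Suc j)))
        (0\<^sub>m r 1) (Matrix.mat r r (\<lambda>(i, j). f (Suc i) (Suc j)))"
  proof (rule eq_matI, goal_cases)
    case (1 i j)
    then show ?case
      using assms by (cases i; cases j) auto
  qed auto
  moreover have "Determinant.det (Matrix.mat 1 1 (\<lambda>(i, j). f 0 0)) = f 0 0"
    by (subst det_single) auto
  ultimately show ?thesis
    by (simp add: det_four_block_mat_lower_left_zero_col[of _ _ r])
qed

text \<open>
  One step of Gaussian elimination that subtracts from each row a multiple of its predecessor. For the Hankel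
  matrices below it maps the family of matrices to itself.
\<close>
lemma fdet_eliminate_first_column:
  assumes "\<And>i. i < r \<Longrightarrow> f (Suc i) 0 = c i * f i 0"
  shows "fdet (Suc r) f = f 0 0 * fdet r (\<lambda>i j. f (Suc i) (Suc j) - c i * f i (Suc j))"
proof -
  define L where "L i j = (if i = j then 1 else if i = Suc j then - c j else 0)" for i j
  define g where "g i j = (case i of 0 \<Rightarrow> f 0 j | Suc i' \<Rightarrow> f i j - c i' * f i' j)" for i j
  have "(\<Sum>l<Suc r. L i l * f l j) = g i j" if i: "i < Suc r" for i j
  proof (cases i)
    case 0
    have "(\<Sum>l<Suc r. L i l * f l j) = (\<Sum>l\<in>{0}. L i l * f l j)"
      by (rule sum.mono_neutral_right) (auto simp: L_def 0)
    then show ?thesis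
      by (simp add: 0 L_def g_def)
  next
    case (Suc i')
    have "(\<Sum>l<Suc r. L i l * f l j) = (\<Sum>l\<in>{i, i'}. L i l * f l j)"
      using i by (intro sum.mono_neutral_right) (auto simp: L_def Suc)
    then show ?thesis
      by (simp add: Suc L_def g_def)
  qed
  then have "Matrix.mat (Suc r) (Suc r) (\<lambda>(i, j). \<Sum>l<Suc r. L i l * f l j) =
      Matrix.mat (Suc r) (Suc r) (\<lambda>(i, j). g i j)"
    by (intro eq_matI) auto
  then have "fdet (Suc r) L * fdet (Suc r) f = fdet (Suc r) g"
    by (simp only: fdet_mult)
  moreover have "fdet (Suc r) L = 1"
    by (subst fdet_lower_triangular) (auto simp: L_def)
  moreover have "fdet (Suc r) g = g 0 0 * fdet r (\<lambda>i j. g (Suc i) (Suc j))"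
    by (rule fdet_first_column_0) (use assms in \<open>simp add: g_def\<close>)
  ultimately show ?thesis
    by (simp add: g_def)
qed

text \<open>
  A product of \<open>j\<close> linear factors is a polynomial of degree \<open>j\<close>, hence a combination of the Newton
  polynomials with nodes \<open>x\<close>. Only its leading coefficient is needed explicitly.
\<close>
lemma newton_expansion:
  fixes \<alpha> \<beta> x :: "nat \<Rightarrow> real"
  shows "\<exists>c. c j = (\<Prod>l<j. \<beta> l) \<and>
    (\<forall>t. (\<Prod>l<j. \<alpha> l + \<beta> l * t) = (\<Sum>l\<le>j. c l * (\<Prod>s<l. t - x s)))"
proof (induction j)
  case 0
  show ?case by (rule exI[of _ "\<lambda>_. 1"]) simp
next
  case (Suc j)
  then obtain c where c: "c j = (\<Prod>l<j. \<beta> l)"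
    "\<And>t. (\<Prod>l<j. \<alpha> l + \<beta> l * t) = (\<Sum>l\<le>j. c l * (\<Prod>s<l. t - x s))"
    by blast
  \<comment> \<open>Multiplication by the next factor uses \<open>t * N l = N (Suc l) + x l * N l\<close> for the Newton polynomials \<open>N\<close>.\<close>
  define d where "d l = (if l \<le> j then c l * (\<alpha> j + \<beta> j * x l) else 0) +
    (case l of 0 \<Rightarrow> 0 | Suc l' \<Rightarrow> \<beta> j * c l')" for l
  have "(\<Prod>l<Suc j. \<alpha> l + \<beta> l * t) = (\<Sum>l\<le>Suc j. d l * (\<Prod>s<l. t - x s))" for t
  proof -
    have "(\<Prod>l<Suc j. \<alpha> l + \<beta> l * t) =
        (\<Sum>l\<le>j. c l * (\<alpha> j + \<beta> j * x l) * (\<Prod>s<l. t - x s)) +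
        (\<Sum>l\<le>j. \<beta> j * c l * (\<Prod>s<Suc l. t - x s))"
      unfolding prod.lessThan_Suc c(2) sum_distrib_right sum.distrib[symmetric]
      by (intro sum.cong) (simp_all add: algebra_simps)
    also have "(\<Sum>l\<le>j. c l * (\<alpha> j + \<beta> j * x l) * (\<Prod>s<l. t - x s)) =
        (\<Sum>l\<le>Suc j. (if l \<le> j then c l * (\<alpha> j + \<beta> j * x l) else 0) * (\<Prod>s<l. t - x s))"
      by simp
    also have "(\<Sum>l\<le>j. \<beta> j * c l * (\<Prod>s<Suc l. t - x s)) =
        (\<Sum>l\<le>Suc j. (case l of 0 \<Rightarrow> 0 | Suc l' \<Rightarrow> \<beta> j * c l') * (\<Prod>s<l. t - x s))"
      by (simp add: sum.atMost_Suc_shift del: sum.atMost_Suc)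
    finally show ?thesis
      by (simp only: d_def distrib_right sum.distrib)
  qed
  moreover have "d (Suc j) = (\<Prod>l<Suc j. \<beta> l)"
    by (simp add: d_def c(1) mult.commute)
  ultimately show ?case by blast
qed

text \<open>
  In the Newton basis with nodes \<open>x\<close> the evaluation matrix is lower triangular, and the change of basis is
  upper triangular, so both determinants are read off their diagonals.
\<close>
lemma vandermonde_newton_basis:
  "fdet r (\<lambda>i j. \<Prod>l<j. \<alpha> l + \<beta> l * x i) =
   (\<Prod>j<r. \<Prod>l<j. \<beta> l) * (\<Prod>i<r. \<Prod>l<i. x i - x l)"
proof -
  obtain c where diag: "\<And>j. c j j = (\<Prod>l<j. \<beta> l)" and
    expand: "\<And>j t. (\<Prod>l<j. \<alpha> l + \<beta> l * t) = (\<Sum>l\<le>j. c j l * (\<Prod>s<l. t - x s))"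
    using newton_expansion[of _ \<beta> \<alpha> x] by metis
  define N where "N i l = (\<Prod>s<l. x i - x s)" for i l
  define C where "C l j = (if l \<le> j then c j l else 0)" for l j
  have "(\<Prod>l<j. \<alpha> l + \<beta> l * x i) = (\<Sum>l<r. N i l * C l j)" if "j < r" for i j
  proof -
    have "(\<Sum>l<r. N i l * C l j) = (\<Sum>l\<le>j. N i l * C l j)"
      using that by (intro sum.mono_neutral_right) (auto simp: C_def)
    then show ?thesis
      by (simp add: expand C_def N_def mult.commute)
  qed
  then have "Matrix.mat r r (\<lambda>(i, j). \<Prod>l<j. \<alpha> l + \<beta> l * x i) =
      Matrix.mat r r (\<lambda>(i, j). \<Sum>l<r. N i l * C l j)"
    by (intro eq_matI) auto
  then have "fdet r (\<lambda>i j. \<Prod>l<j. \<alpha> l + \<beta> l * x i) = fdet r N * fdet r C"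
    by (simp only: fdet_mult)
  also have "fdet r N = (\<Prod>i<r. \<Prod>l<i. x i - x l)"
    by (subst fdet_lower_triangular) (auto simp: N_def)
  also have "fdet r C = (\<Prod>j<r. \<Prod>l<j. \<beta> l)"
    by (subst fdet_transpose[symmetric], subst fdet_lower_triangular) (auto simp: C_def diag)
  finally show ?thesis
    by simp
qed

text \<open>
  Expanding both determinants and summing over each variable separately leaves a double sum over
  permutations \<open>p\<close>, \<open>p'\<close>. For every fixed \<open>p\<close> the sum over \<open>p'\<close> is the same determinant: permuting its
  rows produces a second sign of \<open>p\<close>, which cancels the first.
\<close>
lemma andreief:
  assumes S: "finite S"
  shows "(\<Sum>k \<in> {1..r} \<rightarrow>\<^sub>E S. fdet r (\<lambda>i j. \<phi> j (k (Suc i))) * fdet r (\<lambda>i j. \<psi> j (k (Suc i))) *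
            (\<Prod>i = 1..r. w (k i))) =
         fact r * fdet r (\<lambda>i j. \<Sum>s\<in>S. \<phi> i s * \<psi> j s * w s)"
proof -
  define P where "P = {p. p permutes {0..<r}}"
  define M where "M i j = (\<Sum>s\<in>S. \<phi> i s * \<psi> j s * w s)" for i j
  have shift: "(\<Prod>i = 1..r. g i) = (\<Prod>i = 0..<r. g (Suc i))" for g :: "nat \<Rightarrow> real"
    by (simp add: prod.atLeast1_atMost_eq atLeast0LessThan)
  have inner: "(\<Sum>k \<in> {1..r} \<rightarrow>\<^sub>E S. (\<Prod>i = 0..<r. \<phi> (p i) (k (Suc i))) *
      (\<Prod>i = 0..<r. \<psi> (p' i) (k (Suc i))) * (\<Prod>i = 1..r. w (k i))) = (\<Prod>i = 0..<r. M (p i) (p' i))"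
    for p p'
  proof -
    have "(\<Prod>i = 0..<r. M (p i) (p' i)) =
        (\<Prod>i = 1..r. \<Sum>s\<in>S. \<phi> (p (i - 1)) s * \<psi> (p' (i - 1)) s * w s)"
      unfolding shift M_def by simp
    also have "\<dots> = (\<Sum>k \<in> {1..r} \<rightarrow>\<^sub>E S.
        \<Prod>i = 1..r. \<phi> (p (i - 1)) (k i) * \<psi> (p' (i - 1)) (k i) * w (k i))"
      by (rule prod_sum_PiE) (use S in auto)
    finally show ?thesis
      by (simp add: shift prod.distrib del: One_nat_def)
  qed
  have "(\<Sum>k \<in> {1..r} \<rightarrow>\<^sub>E S. fdet r (\<lambda>i j. \<phi> j (k (Suc i))) * fdet r (\<lambda>i j. \<psi> j (k (Suc i))) *
            (\<Prod>i = 1..r. w (k i))) =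
      (\<Sum>k \<in> {1..r} \<rightarrow>\<^sub>E S. \<Sum>p\<in>P. \<Sum>p'\<in>P. signof p * signof p' *
        ((\<Prod>i = 0..<r. \<phi> (p i) (k (Suc i))) * (\<Prod>i = 0..<r. \<psi> (p' i) (k (Suc i))) *
         (\<Prod>i = 1..r. w (k i))))"
    unfolding fdet_leibniz P_def[symmetric] sum_product sum_distrib_right
    by (simp add: sum_distrib_left mult_ac)
  also have "\<dots> = (\<Sum>p\<in>P. \<Sum>p'\<in>P. signof p * signof p' *
      (\<Sum>k \<in> {1..r} \<rightarrow>\<^sub>E S. (\<Prod>i = 0..<r. \<phi> (p i) (k (Suc i))) *
        (\<Prod>i = 0..<r. \<psi> (p' i) (k (Suc i))) * (\<Prod>i = 1..r. w (k i))))"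
    unfolding sum_distrib_left
    by (subst sum.swap, rule sum.cong[OF refl], rule sum.swap)
  also have "\<dots> = (\<Sum>p\<in>P. signof p * fdet r (\<lambda>i j. M (p i) j))"
    unfolding inner fdet_leibniz P_def by (simp add: sum_distrib_left mult_ac)
  also have "\<dots> = (\<Sum>p\<in>P. fdet r M)"
    by (intro sum.cong) (auto simp: P_def fdet_permute_rows sign_def)
  also have "\<dots> = fact r * fdet r M"
    by (simp add: P_def card_permutations[of _ r])
  finally show ?thesis
    by (simp add: M_def)
qed

section \<open>A Hankel determinant of infinite products\<close>

lemma prod_triangle_Suc:
  fixes g :: "nat \<Rightarrow> nat \<Rightarrow> real"
  shows "(\<Prod>i<Suc r. \<Prod>l = 1..<Suc r - i. g i l) =
    (\<Prod>i<r. \<Prod>l = 1..<r - i. g i l) * (\<Prod>i<r. g i (r - i))"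
proof -
  have "(\<Prod>l = 1..<Suc r - i. g i l) = (\<Prod>l = 1..<r - i. g i l) * g i (r - i)" if "i < r" for i
    using that by (simp add: Suc_diff_le)
  then show ?thesis
    by (simp add: prod.distrib)
qed

context
  fixes q :: real
  assumes q: "0 < q" "q < 1"
begin

lemma q_euler_shift_down: "q_euler q (x - real r) = (\<Prod>l = 1..r. 1 - q powr (x - real l)) * q_euler q x"
proof (induction r)
  case (Suc r)
  then show ?case
    using q_euler_rec[OF q, of "x - real (Suc r)"] by (simp add: algebra_simps)
qed simp

text \<open>
  After one elimination step the entries are \<open>a i * b j\<close> times the entries of the same matrix with \<open>x - 2\<close> and \<open>y - 1\<close>
  in place of \<open>x\<close> and \<open>y\<close>, because the difference of two neighbouring quotients factorizes. The
  hypothesis on \<open>x\<close> keeps all denominators nonzero.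
\<close>
lemma det_euler_ratio:
  assumes "x \<notin> \<int>"
  shows "fdet r (\<lambda>i j. q_euler q (y - real i - real j) / q_euler q (x - real i - real j)) =
    (\<Prod>i<r. q_euler q (y - real i) / q_euler q (x - real i - (real r - 1))) *
    (\<Prod>i<r. \<Prod>l = 1..<r - i. (q powr (x - 2 * real i) - q powr (y - real i)) *
       (q powr (- 2 * real l) * (1 - q powr real l)))"
  using assms
proof (induction r arbitrary: x y)
  case 0
  show ?case by (simp add: Determinant.det_def)
next
  case (Suc r)
  define f where "f i j = q_euler q (y - real i - real j) / q_euler q (x - real i - real j)" for i j
  define c where "c i = (1 - q powr (y - real i - 1)) / (1 - q powr (x - real i - 1))" for i
  define a where "a i = (q powr x - q powr y) * q powr (- real (Suc i)) / (1 - q powr (x - real (Suc i)))" for i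
  define b where "b j = q powr (- real (Suc j)) * (1 - q powr (real (Suc j)))" for j
  have notint: "x - real i \<notin> \<int>" for i
    using Suc.prems by (metis Ints_add Ints_of_nat diff_add_cancel)
  have ne: "1 - q powr (x - real i) \<noteq> 0" for i
    using notint[of i] q powr_eq_one_iff_gen[of q "x - real i"] by auto
  have e_ne: "q_euler q (x - real i) \<noteq> 0" for i
    using notint[of i] q_euler_eq_0_iff[OF q] nonpos_Ints_Int by blast
  have col: "f (Suc i) 0 = c i * f i 0" for i
    using q_euler_rec[OF q, of "y - real i - 1"] q_euler_rec[OF q, of "x - real i - 1"]
    by (simp add: f_def c_def diff_diff_eq add.commute)
  \<comment> \<open>The numerator \<open>(1 - Y s t) (1 - X s) - (1 - Y s) (1 - X s t)\<close> equals \<open>(X - Y) s (t - 1)\<close>.\<close>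
  have entry: "f (Suc i) (Suc j) - c i * f i (Suc j) =
      a i * b j * (q_euler q ((y - 1) - real i - real j) / q_euler q ((x - 2) - real i - real j))" for i j
  proof -
    define s t where "s = q powr (- real (Suc i))" and "t = q powr (- real (Suc j))"
    define X Y where "X = q powr x" and "Y = q powr y"
    define u v where "u = q_euler q (y - real (Suc (i + j)))" and "v = q_euler q (x - real (Suc (i + j)))"
    have st: "s > 0" "t > 0"
      using q by (auto simp: s_def t_def)
    have pw: "q powr (w - real (Suc i)) = q powr w * s"
      "q powr (w - real (Suc (Suc (i + j)))) = q powr w * s * t" for w
      by (simp_all add: s_def t_def algebra_simps flip: powr_add)
    have d: "1 - X * s \<noteq> 0" "1 - X * s * t \<noteq> 0"
      using ne[of "Suc i"] ne[of "Suc (Suc (i + j))"] by (simp_all only: pw X_def simp_thms)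
    have v0: "v \<noteq> 0"
      unfolding v_def by (rule e_ne)
    have rec: "q_euler q (w - real (Suc (Suc (i + j)))) = (1 - q powr w * s * t) * q_euler q (w - real (Suc (i + j)))" for w
    proof -
      have "w - real (Suc (Suc (i + j))) + 1 = w - real (Suc (i + j))"
        by simp
      then show ?thesis
        using q_euler_rec[OF q, of "w - real (Suc (Suc (i + j)))"] by (simp only: pw)
    qed
    have f1: "f (Suc i) (Suc j) = ((1 - Y * s * t) * u) / ((1 - X * s * t) * v)"
    proof -
      have "w - real (Suc i) - real (Suc j) = w - real (Suc (Suc (i + j)))" for w :: real
        by simp
      then show ?thesis
        unfolding f_def u_def v_def X_def Y_def by (simp only: rec)
    qed
    have f0: "f i (Suc j) = u / v"
    proof -
      have "w - real i - real (Suc j) = w - real (Suc (i + j))" for w :: real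
        by simp
      then show ?thesis
        by (simp only: f_def u_def v_def)
    qed
    have last: "q_euler q ((y - 1) - real i - real j) / q_euler q ((x - 2) - real i - real j) =
        u / ((1 - X * s * t) * v)"
    proof -
      have "(y - 1) - real i - real j = y - real (Suc (i + j))"
        "(x - 2) - real i - real j = x - real (Suc (Suc (i + j)))"
        by simp_all
      then show ?thesis
        unfolding u_def v_def X_def by (simp only: rec)
    qed
    have ct: "c i = (1 - Y * s) / (1 - X * s)"
      unfolding c_def X_def Y_def pw[symmetric] by (simp add: diff_diff_eq add.commute)
    have at: "a i = (X - Y) * s / (1 - X * s)"
      unfolding a_def pw by (simp add: X_def Y_def s_def)
    have bt: "b j = t - 1"
      using q by (simp add: b_def t_def right_diff_distrib flip: powr_add)
    show ?thesis
      unfolding f1 f0 last ct at bt using d v0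
      by (simp add: divide_simps) (simp add: algebra_simps)
  qed
  have "fdet (Suc r) f = f 0 0 * fdet r (\<lambda>i j. a i * b j *
      (q_euler q ((y - 1) - real i - real j) / q_euler q ((x - 2) - real i - real j)))"
    using fdet_eliminate_first_column[of r f c] col by (simp only: entry)
  also have "\<dots> = f 0 0 * ((\<Prod>i<r. a i) * (\<Prod>j<r. b j) *
      fdet r (\<lambda>i j. q_euler q ((y - 1) - real i - real j) / q_euler q ((x - 2) - real i - real j)))"
    by (simp only: fdet_scale)
  also have "fdet r (\<lambda>i j. q_euler q ((y - 1) - real i - real j) / q_euler q ((x - 2) - real i - real j)) =
      (\<Prod>i<r. q_euler q (y - real (Suc i)) / q_euler q (x - real (Suc i) - (real (Suc r) - 1))) *
      (\<Prod>i<r. \<Prod>l = 1..<Suc r - Suc i. (q powr (x - 2 * real (Suc i)) - q powr (y - real (Suc i))) *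
         (q powr (- 2 * real l) * (1 - q powr real l)))"
  proof -
    have notint2: "x - 2 \<notin> \<int>"
      using notint[of 2] by simp
    have "(y - 1) - real i = y - real (Suc i)"
      "(x - 2) - real i - (real r - 1) = x - real (Suc i) - (real (Suc r) - 1)"
      "x - 2 - 2 * real i = x - 2 * real (Suc i)" for i
      by simp_all
    then show ?thesis
      using Suc.IH[OF notint2, of "y - 1"] by (simp only: diff_Suc_Suc)
  qed
  also have "f 0 0 * ((\<Prod>i<r. a i) * (\<Prod>j<r. b j) * (P1 * P2)) =
      (q_euler q y / q_euler q (x - real r) * P1) *
      ((\<Prod>l = 1..<Suc r. (q powr x - q powr y) * (q powr (- 2 * real l) * (1 - q powr real l))) * P2)"
    for P1 P2
  proof -
    have "(\<Prod>i<r. a i) * (\<Prod>j<r. b j) =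
        (\<Prod>l = 1..<Suc r. (q powr x - q powr y) * (q powr (- 2 * real l) * (1 - q powr real l))) /
        (\<Prod>l = 1..r. 1 - q powr (x - real l))"
    proof -
      have "a i * b i = ((q powr x - q powr y) *
          (q powr (- 2 * real (Suc i)) * (1 - q powr real (Suc i)))) / (1 - q powr (x - real (Suc i)))" for i
      proof -
        have "q powr (- 2 * real (Suc i)) = q powr (- real (Suc i)) * q powr (- real (Suc i))"
          by (simp flip: powr_add)
        then show ?thesis
          by (simp only: a_def b_def) (simp add: mult_ac)
      qed
      then have "(\<Prod>i<r. a i) * (\<Prod>j<r. b j) = (\<Prod>i<r. ((q powr x - q powr y) *
          (q powr (- 2 * real (Suc i)) * (1 - q powr real (Suc i)))) / (1 - q powr (x - real (Suc i))))"
        by (simp only: prod.distrib[symmetric])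
      also have "\<dots> = (\<Prod>l = 1..r. ((q powr x - q powr y) *
          (q powr (- 2 * real l) * (1 - q powr real l))) / (1 - q powr (x - real l)))"
        by (simp only: One_nat_def prod.atLeast1_atMost_eq)
      finally show ?thesis
        by (simp only: prod_dividef atLeastLessThanSuc_atLeastAtMost)
    qed
    then show ?thesis
      by (simp add: f_def q_euler_shift_down mult_ac del: prod.op_ivl_Suc)
  qed
  also have "q_euler q y / q_euler q (x - real r) *
      (\<Prod>i<r. q_euler q (y - real (Suc i)) / q_euler q (x - real (Suc i) - (real (Suc r) - 1))) =
      (\<Prod>i<Suc r. q_euler q (y - real i) / q_euler q (x - real i - (real (Suc r) - 1)))"
    by (subst prod.lessThan_Suc_shift) simp
  also have "(\<Prod>l = 1..<Suc r. (q powr x - q powr y) * (q powr (- 2 * real l) * (1 - q powr real l))) *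
      (\<Prod>i<r. \<Prod>l = 1..<Suc r - Suc i. (q powr (x - 2 * real (Suc i)) - q powr (y - real (Suc i))) *
         (q powr (- 2 * real l) * (1 - q powr real l))) =
      (\<Prod>i<Suc r. \<Prod>l = 1..<Suc r - i. (q powr (x - 2 * real i) - q powr (y - real i)) *
         (q powr (- 2 * real l) * (1 - q powr real l)))"
    by (subst prod.lessThan_Suc_shift) (simp del: prod.op_ivl_Suc)
  finally show ?case
    unfolding f_def .
qed

text \<open>
  The product on the right is \<open>(p; p)\<close> of length \<open>2 i + 1\<close> for \<open>p = \<surd>q\<close>, that is \<open>\<Gamma>\<^sub>p(2 i + 2)\<close> up to a power
  of \<open>1 - p\<close>.
\<close>
lemma q_euler_1_even:
  "q_euler (sqrt q) 1 = (1 - sqrt q) *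
     (\<Prod>l = 1..i. (1 - q powr real l) * (1 - q powr (real l + 1 / 2))) *
     q_euler (sqrt q) (2 * real i + 2)"
proof (induction i)
  case 0
  show ?case
    using q_euler_rec[of "sqrt q" 1] q by simp
next
  case (Suc i)
  have s: "sqrt q powr y = q powr (y / 2)" for y
    using q by (simp add: powr_half_sqrt[symmetric] powr_powr)
  have sq: "0 < sqrt q" "sqrt q < 1"
    using q by auto
  have "2 * real i + 2 + 1 + 1 = 2 * real (Suc i) + 2" "(2 * real i + 2) / 2 = real (Suc i)"
    "(2 * real i + 2 + 1) / 2 = real (Suc i) + 1 / 2"
    by simp_all
  then have "q_euler (sqrt q) (2 * real i + 2) =
      (1 - q powr real (Suc i)) * ((1 - q powr (real (Suc i) + 1 / 2)) * q_euler (sqrt q) (2 * real (Suc i) + 2))"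
    using q_euler_rec[OF sq, of "2 * real i + 2"] q_euler_rec[OF sq, of "2 * real i + 2 + 1"]
    by (simp only: s)
  then show ?case
    using Suc.IH by (simp add: mult_ac)
qed

text \<open>
  The double product left over by \<open>det_euler_ratio\<close> for \<open>x = N - 1 / 2\<close> and \<open>y = N + 1\<close>. Its main power of \<open>q\<close>
  is the product of the leading coefficients of the two polynomial bases, which cancels in the end.
\<close>
lemma triangle_product:
  "(\<Prod>i<r. \<Prod>l = 1..<r - i. (q powr (N - 1 / 2 - 2 * real i) - q powr (N + 1 - real i)) *
       (q powr (- 2 * real l) * (1 - q powr real l))) =
   (\<Prod>i<r. \<Prod>l<i. q powr (N - 2 * real l)) *
   q powr (- (\<Sum>s<r. (real s)\<^sup>2 + 3 / 2 * real s)) *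
   (\<Prod>i<r. \<Prod>l = 1..i. (1 - q powr real l) * (1 - q powr (real l + 1 / 2)))"
proof (induction r)
  case 0
  show ?case using q by simp
next
  case (Suc r)
  have "(\<Prod>i<r. (q powr (N - 1 / 2 - 2 * real i) - q powr (N + 1 - real i)) *
       (q powr (- 2 * real (r - i)) * (1 - q powr real (r - i)))) =
      (\<Prod>i<r. q powr (N - 1 / 2 - 2 * real r) * (1 - q powr (real i + 3 / 2)) * (1 - q powr real (r - i)))"
  proof (rule prod.cong)
    fix i assume "i \<in> {..<r}"
    then have "real (r - i) = real r - real i"
      by simp
    then have "q powr (N - 1 / 2 - 2 * real i) * q powr (- 2 * real (r - i)) = q powr (N - 1 / 2 - 2 * real r)"
      "q powr (N + 1 - real i) = q powr (N - 1 / 2 - 2 * real i) * q powr (real i + 3 / 2)"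
      by (simp_all add: algebra_simps flip: powr_add)
    then show "(q powr (N - 1 / 2 - 2 * real i) - q powr (N + 1 - real i)) *
        (q powr (- 2 * real (r - i)) * (1 - q powr real (r - i))) =
        q powr (N - 1 / 2 - 2 * real r) * (1 - q powr (real i + 3 / 2)) * (1 - q powr real (r - i))"
      by (simp add: algebra_simps)
  qed simp
  also have "\<dots> = q powr (real r * (N - 1 / 2 - 2 * real r)) *
      ((\<Prod>i<r. 1 - q powr (real i + 3 / 2)) * (\<Prod>i<r. 1 - q powr real (r - i)))"
    using q by (simp add: prod.distrib powr_powr mult.commute flip: powr_realpow)
  also have "(\<Prod>i<r. 1 - q powr (real i + 3 / 2)) = (\<Prod>l = 1..r. 1 - q powr (real l + 1 / 2))"
    by (simp add: prod.atLeast1_atMost_eq add_ac)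
  also have "(\<Prod>i<r. 1 - q powr real (r - i)) = (\<Prod>l = 1..r. 1 - q powr real l)"
  proof -
    have "(\<Prod>i<r. 1 - q powr real (r - i)) = (\<Prod>i<r. 1 - q powr real (Suc i))"
      by (subst prod.nat_diff_reindex[symmetric]) (auto intro!: prod.cong)
    then show ?thesis
      by (simp add: prod.atLeast1_atMost_eq)
  qed
  also have "q powr (real r * (N - 1 / 2 - 2 * real r)) =
      (\<Prod>l<r. q powr (N - 2 * real l)) * q powr (- ((real r)\<^sup>2 + 3 / 2 * real r))"
  proof -
    have "(\<Sum>l<r. N - 2 * real l) = real r * N - real r * (real r - 1)" for r
      by (induction r) (simp_all add: algebra_simps)
    then have "(\<Prod>l<r. q powr (N - 2 * real l)) = q powr (real r * N - real r * (real r - 1))"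
      using q by (simp flip: powr_sum)
    then show ?thesis
      by (simp add: power2_eq_square algebra_simps flip: powr_add)
  qed
  finally have "(\<Prod>i<r. (q powr (N - 1 / 2 - 2 * real i) - q powr (N + 1 - real i)) *
       (q powr (- 2 * real (r - i)) * (1 - q powr real (r - i)))) =
      (\<Prod>l<r. q powr (N - 2 * real l)) * q powr (- ((real r)\<^sup>2 + 3 / 2 * real r)) *
      (\<Prod>l = 1..r. (1 - q powr real l) * (1 - q powr (real l + 1 / 2)))"
    by (simp add: prod.distrib mult_ac)
  moreover have "q powr (- (\<Sum>s<Suc r. (real s)\<^sup>2 + 3 / 2 * real s)) =
      q powr (- (\<Sum>s<r. (real s)\<^sup>2 + 3 / 2 * real s)) * q powr (- ((real r)\<^sup>2 + 3 / 2 * real r))"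
    by (simp flip: powr_add)
  ultimately show ?case
    unfolding prod_triangle_Suc Suc.IH prod.lessThan_Suc by (simp only: mult_ac)
qed

end

section \<open>Evaluation of the multiple sum\<close>

definition selberg_const :: "real \<Rightarrow> nat \<Rightarrow> real" where
  "selberg_const q r =
     (\<Prod>j<r. (1 / (1 - q) ^ 4) ^ j) *
     (2 * (q powr (- (1 / 2)) * (1 - sqrt q) / ((1 - q) * (1 - q\<^sup>2) * q_euler (sqrt q) 1))) ^ r *
     q powr (- (\<Sum>s<r. (real s)\<^sup>2 + 3 / 2 * real s)) *
     (\<Prod>i<r. \<Prod>l = 1..i. (1 - q powr real l) * (1 - q powr (real l + 1 / 2)))"

text \<open>
  The common value of both sides: the right-hand side of the identity after the duplication formula
  has removed its removable singularities. All denominators are nonzero at the admissible \<open>m\<close> and \<open>n\<close>.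
\<close>
definition selberg_value :: "real \<Rightarrow> nat \<Rightarrow> real \<Rightarrow> real \<Rightarrow> real" where
  "selberg_value q r m n =
     fact r * selberg_const q r *
     (\<Prod>i<r. q_euler (sqrt q) (2 * n - 2 * real i) * q_euler (sqrt q) (2 * m - 2 * real i) *
        q_euler q (m + n + 1 - real i) /
        (q_euler q (2 * n + 1) * q_euler q (2 * m + 1) * q_euler q (m + n + 1 / 2 - real i - real r)))"

definition symmetric_lattice :: "real \<Rightarrow> real \<Rightarrow> real" where
  "symmetric_lattice q k = q powr k + q powr (- k)"

definition one_body_weight :: "real \<Rightarrow> real \<Rightarrow> real \<Rightarrow> real \<Rightarrow> real" where
  "one_body_weight q m n k =
     q powr (k\<^sup>2 - 3 / 2 * k) * \<bar>q_number (q\<^sup>2) k * q_number q k\<bar> *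
     q_binomial q \<lfloor>2 * n\<rfloor> \<lfloor>n + k\<rfloor> * q_binomial q \<lfloor>2 * m\<rfloor> \<lfloor>m + k\<rfloor>"

lemma prod_pairs:
  fixes g :: "nat \<Rightarrow> nat \<Rightarrow> real"
  shows "(\<Prod>(i, j) \<in> {(i, j). 1 \<le> i \<and> i < j \<and> j \<le> r}. g i j) = (\<Prod>j<r. \<Prod>i<j. g (Suc i) (Suc j))"
proof -
  have "(\<Prod>j<r. \<Prod>i<j. g (Suc i) (Suc j)) = (\<Prod>(j, i)\<in>Sigma {..<r} (\<lambda>j. {..<j}). g (Suc i) (Suc j))"
    by (rule prod.Sigma) auto
  also have "\<dots> = (\<Prod>(i, j) \<in> {(i, j). 1 \<le> i \<and> i < j \<and> j \<le> r}. g i j)"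
    by (rule prod.reindex_bij_witness[of _ "\<lambda>(i, j). (j - 1, i - 1)" "\<lambda>(j, i). (Suc i, Suc j)"]) auto
  finally show ?thesis ..
qed

context
  fixes q :: real
  assumes q: "0 < q" "q < 1"
begin

text \<open>
  The pair \<open>i < j\<close> contributes \<open>q powr (2 * k j)\<close>, so the \<open>j\<close>-th variable collects this \<open>j - 1\<close> times. Together
  with the exponent \<open>- (2 * j - 1 / 2) * k j\<close> this gives \<open>- 3 / 2 * k j\<close> for every \<open>j\<close>.
\<close>
lemma summand_eq:
  "(\<Prod>(i, j) \<in> {(i, j). 1 \<le> i \<and> i < j \<and> j \<le> r}.
      (q_number q (k j - k i))\<^sup>2 * (q_number q (k i + k j))\<^sup>2) *
   (\<Prod>i = 1..r.
      q powr ((k i)\<^sup>2 - (2 * real i - 1 / 2) * k i) * \<bar>q_number (q\<^sup>2) (k i) * q_number q (k i)\<bar> *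
      q_binomial q \<lfloor>2 * n\<rfloor> \<lfloor>n + k i\<rfloor> * q_binomial q \<lfloor>2 * m\<rfloor> \<lfloor>m + k i\<rfloor>) =
   (\<Prod>j<r. (1 / (1 - q) ^ 4) ^ j) *
   ((\<Prod>j<r. \<Prod>i<j. symmetric_lattice q (k (Suc j)) - symmetric_lattice q (k (Suc i)))\<^sup>2 *
    (\<Prod>i = 1..r. one_body_weight q m n (k i)))"
proof -
  have pair: "(q_number q (b - a))\<^sup>2 * (q_number q (a + b))\<^sup>2 =
      q powr (2 * b) * (1 / (1 - q) ^ 4) * (symmetric_lattice q b - symmetric_lattice q a)\<^sup>2" for a b
  proof -
    have "(1 - q powr (b - a)) * (1 - q powr (a + b)) =
        q powr b * (symmetric_lattice q b - symmetric_lattice q a)"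
      using q by (simp add: symmetric_lattice_def powr_add powr_diff powr_minus field_simps)
    moreover have "q_number q (b - a) * q_number q (a + b) =
        (1 - q powr (b - a)) * (1 - q powr (a + b)) / (1 - q)\<^sup>2"
      by (simp add: q_number_def power2_eq_square)
    ultimately have "(q_number q (b - a) * q_number q (a + b))\<^sup>2 =
        (q powr b)\<^sup>2 * (symmetric_lattice q b - symmetric_lattice q a)\<^sup>2 / ((1 - q)\<^sup>2)\<^sup>2"
      by (simp only: power_divide power_mult_distrib)
    moreover have "(q powr b)\<^sup>2 = q powr (2 * b)"
      by (simp add: power2_eq_square flip: powr_add)
    ultimately show ?thesis
      by (simp add: power_mult_distrib flip: power_mult)
  qed
  have shift: "(\<Prod>i = 1..r. g i) = (\<Prod>i<r. g (Suc i))" for g :: "nat \<Rightarrow> real"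
    by (simp add: prod.atLeast1_atMost_eq)
  define F where "F i = q powr ((k i)\<^sup>2 - (2 * real i - 1 / 2) * k i) *
    \<bar>q_number (q\<^sup>2) (k i) * q_number q (k i)\<bar> *
    q_binomial q \<lfloor>2 * n\<rfloor> \<lfloor>n + k i\<rfloor> * q_binomial q \<lfloor>2 * m\<rfloor> \<lfloor>m + k i\<rfloor>" for i
  have pairs: "(\<Prod>(i, j) \<in> {(i, j). 1 \<le> i \<and> i < j \<and> j \<le> r}.
      (q_number q (k j - k i))\<^sup>2 * (q_number q (k i + k j))\<^sup>2) =
      (\<Prod>j<r. (q powr (2 * k (Suc j))) ^ j) * (\<Prod>j<r. (1 / (1 - q) ^ 4) ^ j) *
      (\<Prod>j<r. \<Prod>i<j. symmetric_lattice q (k (Suc j)) - symmetric_lattice q (k (Suc i)))\<^sup>2"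
    unfolding prod_pairs
    by (simp only: pair prod.distrib prod_constant card_lessThan prod_power_distrib)
  have weights: "(\<Prod>j<r. (q powr (2 * k (Suc j))) ^ j) * (\<Prod>i = 1..r. F i) =
      (\<Prod>i = 1..r. one_body_weight q m n (k i))"
  proof -
    have "(q powr (2 * k (Suc j))) ^ j * F (Suc j) = one_body_weight q m n (k (Suc j))" for j
    proof -
      define x where "x = k (Suc j)"
      have "(q powr (2 * x)) ^ j = q powr (2 * x * real j)"
        using q by (simp add: powr_power mult_ac)
      moreover have "2 * x * real j + (x\<^sup>2 - (2 * real (Suc j) - 1 / 2) * x) = x\<^sup>2 - 3 / 2 * x"
        by (simp add: field_simps)
      ultimately have "(q powr (2 * x)) ^ j * q powr (x\<^sup>2 - (2 * real (Suc j) - 1 / 2) * x) =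
          q powr (x\<^sup>2 - 3 / 2 * x)"
        by (simp only: powr_add[symmetric])
      then show ?thesis
        unfolding one_body_weight_def F_def x_def by (simp only: mult.assoc[symmetric])
    qed
    then have "(\<Prod>j<r. (q powr (2 * k (Suc j))) ^ j * F (Suc j)) = (\<Prod>j<r. one_body_weight q m n (k (Suc j)))"
      by (simp only:)
    then show ?thesis
      by (simp only: shift prod.distrib)
  qed
  show ?thesis
    unfolding F_def[symmetric] pairs weights[symmetric] by (simp only: mult_ac)
qed

lemma q_pochhammer_eq_euler: "q_pochhammer q q j = q_euler q 1 / q_euler q (real j + 1)"
proof (induction j)
  case 0
  show ?case
    using q_euler_pos_nonzero[OF q, of 1] by (simp add: q_pochhammer_def)
next
  case (Suc j)
  have nz: "q_euler q (real j + 1) \<noteq> 0"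
    by (rule q_euler_pos_nonzero[OF q]) simp
  have "q_pochhammer q q (Suc j) = q_pochhammer q q j * (1 - q powr (real j + 1))"
    using q by (simp add: q_pochhammer_def powr_add powr_realpow mult.commute)
  moreover have "q_euler q (real j + 1) = (1 - q powr (real j + 1)) * q_euler q (real (Suc j) + 1)"
    using q_euler_rec[OF q, of "real j + 1"] by (simp add: add_ac)
  ultimately show ?case
    using nz by (simp add: Suc.IH)
qed

lemma q_binomial_eq_euler:
  "q_binomial q (int N) M =
    q_euler q (real_of_int M + 1) * q_euler q (real N - real_of_int M + 1) / (q_euler q 1 * q_euler q (real N + 1))"
proof (cases "0 \<le> M \<and> M \<le> int N")
  case True
  then obtain j where j: "M = int j" "j \<le> N"
    by (metis of_nat_le_iff zero_le_imp_eq_int)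
  have "q_euler q (real N + 1) \<noteq> 0" "q_euler q 1 \<noteq> 0"
    by (auto intro!: q_euler_pos_nonzero[OF q])
  moreover have "nat (int N - int j) = N - j"
    by simp
  ultimately show ?thesis
    using j by (simp add: q_binomial_def q_pochhammer_eq_euler of_nat_diff)
next
  case False
  then have "M + 1 \<le> 0 \<or> int N - M + 1 \<le> 0"
    by auto
  then have "real_of_int (M + 1) \<in> \<int>\<^sub>\<le>\<^sub>0 \<or> real_of_int (int N - M + 1) \<in> \<int>\<^sub>\<le>\<^sub>0"
    by (metis nonpos_Ints_of_int)
  then show ?thesis
    using False by (auto simp: q_binomial_def q_euler_eq_0_iff[OF q])
qed

text \<open>
  The two factors that shift a \<open>q\<close>-binomial coefficient are quadratic in \<open>q powr k\<close> but jointly linear in the lattice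
  variable, so their products form a polynomial basis.
\<close>
lemma node_factor:
  "(1 - q powr (n - k - t)) * (1 - q powr (n + k - t)) =
   (1 + q powr (2 * (n - t))) + (- (q powr (n - t))) * symmetric_lattice q k"
proof -
  have "q powr (n - k - t) = q powr (n - t) * q powr (- k)" "q powr (n + k - t) = q powr (n - t) * q powr k"
    "q powr (2 * (n - t)) = q powr (n - t) * q powr (n - t)" "q powr k * q powr (- k) = 1"
    using q by (simp_all add: algebra_simps flip: powr_add)
  then show ?thesis
    by (simp add: symmetric_lattice_def algebra_simps)
qed

lemma node_factors_lower_degree:
  "(\<Prod>l<i. (1 - q powr (n - k - real l)) * (1 - q powr (n + k - real l))) *
     (q_euler q (n + k + 1) * q_euler q (n - k + 1)) =
   q_euler q (n - real i + k + 1) * q_euler q (n - real i - k + 1)"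
proof -
  have "n + k + 1 - real i = n - real i + k + 1" "n - k + 1 - real i = n - real i - k + 1"
    "n + k + 1 - real (Suc l) = n + k - real l" "n - k + 1 - real (Suc l) = n - k - real l" for l
    by simp_all
  then show ?thesis
    using q_euler_shift_down[OF q, of "n + k + 1" i] q_euler_shift_down[OF q, of "n - k + 1" i]
    by (simp only: One_nat_def prod.atLeast1_atMost_eq prod.distrib mult_ac)
qed

text \<open>
  Folds the symmetric range onto its positive part. The number \<open>k0\<close> is the smallest positive element of the lattice of
  integers or half-integers.
\<close>
lemma k_range_sum_abs:
  assumes k0: "k0 = 1 / 2 \<or> k0 = 1" and n: "n = k0 + real J - 1" "n \<ge> 0" and "f 0 = (0::real)"
  shows "(\<Sum>k\<in>k_range n. f \<bar>k\<bar>) = 2 * (\<Sum>j<J. f (k0 + real j))"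
proof -
  define P where "P = (\<lambda>j. k0 + real j) ` {..<J}"
  define Q where "Q = (\<lambda>j. - (k0 + real j)) ` {..<J}"
  have "k_range n - {0} \<subseteq> P \<union> Q"
  proof
    fix k assume "k \<in> k_range n - {0}"
    then obtain i where i: "k = - n + real i" "k \<le> n" "k \<noteq> 0"
      by (auto simp: k_range_def)
    show "k \<in> P \<union> Q"
    proof (cases "i < J")
      case True
      then have "k = - (k0 + real (J - 1 - i))"
        using i n k0 by (auto simp: of_nat_diff)
      moreover have "J - 1 - i \<in> {..<J}"
        using True by simp
      ultimately show ?thesis
        unfolding Q_def by (intro UnI2 image_eqI)
    next
      case False
      define j where "j = i - J - (if k0 = 1 then 1 else 0)"
      have "k = k0 + real j"
      proof (cases "k0 = 1")
        case True
        then have "i \<noteq> J"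
          using i n by auto
        then show ?thesis
          using i n True False by (simp add: j_def of_nat_diff)
      next
        case k0': False
        then show ?thesis
          using i n False k0 by (simp add: j_def of_nat_diff)
      qed
      moreover from this have "j < J"
        using i n by simp
      ultimately show ?thesis
        by (auto simp: P_def)
    qed
  qed
  moreover have "P \<union> Q \<subseteq> k_range n - {0}"
  proof
    fix k assume "k \<in> P \<union> Q"
    then obtain j where j: "j < J" "k = k0 + real j \<or> k = - (k0 + real j)"
      by (auto simp: P_def Q_def)
    have "k = - n + real (if k = k0 + real j then (if k0 = 1 then 1 else 0) + J + j else J - 1 - j)"
      using j n k0 by (auto simp: of_nat_diff)
    moreover have "k \<le> n" "k \<noteq> 0"
      using j n k0 by auto
    ultimately show "k \<in> k_range n - {0}"
      unfolding k_range_def by blast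
  qed
  ultimately have "k_range n - {0} = P \<union> Q" ..
  moreover have "(\<Sum>k\<in>k_range n. f \<bar>k\<bar>) = (\<Sum>k\<in>k_range n - {0}. f \<bar>k\<bar>)"
    by (rule sum.mono_neutral_right) (use assms(4) finite_k_range in auto)
  ultimately have "(\<Sum>k\<in>k_range n. f \<bar>k\<bar>) = (\<Sum>k\<in>P \<union> Q. f \<bar>k\<bar>)"
    by (simp only:)
  also have "\<dots> = (\<Sum>k\<in>P. f \<bar>k\<bar>) + (\<Sum>k\<in>Q. f \<bar>k\<bar>)"
    using k0 by (intro sum.union_disjoint) (auto simp: P_def Q_def)
  also have "(\<Sum>k\<in>P. f \<bar>k\<bar>) = (\<Sum>j<J. f (k0 + real j))"
    using k0 unfolding P_def by (subst sum.reindex) (auto simp: inj_on_def)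
  also have "(\<Sum>k\<in>Q. f \<bar>k\<bar>) = (\<Sum>j<J. f (k0 + real j))"
    using k0 unfolding Q_def by (subst sum.reindex) (auto simp: inj_on_def abs_if add.commute intro!: sum.cong)
  finally show ?thesis
    by simp
qed

text \<open>
  Reflecting \<open>k\<close> multiplies \<open>q_number (q\<^sup>2) k\<close> and \<open>q_number q k\<close> by powers of \<open>q\<close> with total exponent \<open>- 3 * k\<close>, which
  makes up for the change of \<open>- 3 / 2 * k\<close> into \<open>3 / 2 * k\<close>.
\<close>
lemma base_weight_even:
  "q powr (k\<^sup>2 - 3 / 2 * k) * \<bar>q_number (q\<^sup>2) k * q_number q k\<bar> =
   q powr (\<bar>k\<bar>\<^sup>2 - 3 / 2 * \<bar>k\<bar>) * (1 - q powr (2 * \<bar>k\<bar>)) * (1 - q powr \<bar>k\<bar>) / ((1 - q) * (1 - q\<^sup>2))"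
proof -
  have q2: "q\<^sup>2 < 1"
    using q by (simp add: power_less_one_iff)
  have sq: "(q\<^sup>2) powr k = q powr (2 * k)" for k
  proof -
    have "q\<^sup>2 = q powr 2"
      using q by simp
    then show ?thesis
      by (simp only: powr_powr)
  qed
  have le: "q powr x \<le> 1" if "x \<ge> 0" for x
    using that q by (simp add: powr_le1)
  have pos: "q powr (x\<^sup>2 - 3 / 2 * x) * \<bar>q_number (q\<^sup>2) x * q_number q x\<bar> =
      q powr (x\<^sup>2 - 3 / 2 * x) * (1 - q powr (2 * x)) * (1 - q powr x) / ((1 - q) * (1 - q\<^sup>2))"
    if "x \<ge> 0" for x
    using le[of x] le[of "2 * x"] that q q2 by (simp add: q_number_def sq abs_mult mult_ac)
  have "q powr ((- x)\<^sup>2 - 3 / 2 * (- x)) * \<bar>q_number (q\<^sup>2) (- x) * q_number q (- x)\<bar> =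
      q powr (x\<^sup>2 - 3 / 2 * x) * \<bar>q_number (q\<^sup>2) x * q_number q x\<bar>" for x
  proof -
    have "q_number q (- x) = - (q powr (- x)) * q_number q x"
      using q by (simp add: q_number_def powr_minus field_simps)
    moreover have "q_number (q\<^sup>2) (- x) = - (q powr (- 2 * x)) * q_number (q\<^sup>2) x"
    proof -
      have "(1 - inverse z) / c = - (inverse z) * ((1 - z) / c)" if "z \<noteq> 0" for z c :: real
        using that by (cases "c = 0") (simp_all add: field_simps)
      moreover have "q powr (2 * - x) = inverse (q powr (2 * x))" "q powr (- 2 * x) = inverse (q powr (2 * x))"
        by (simp_all flip: powr_minus)
      ultimately show ?thesis
        using q by (simp only: q_number_def sq powr_eq_0_iff)
    qed
    ultimately have "\<bar>q_number (q\<^sup>2) (- x) * q_number q (- x)\<bar> =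
        q powr (- x) * q powr (- 2 * x) * \<bar>q_number (q\<^sup>2) x * q_number q x\<bar>"
      by (simp add: abs_mult)
    moreover have "q powr ((- x)\<^sup>2 - 3 / 2 * (- x)) * (q powr (- x) * q powr (- 2 * x)) =
        q powr (x\<^sup>2 - 3 / 2 * x)"
    proof -
      have "(- x)\<^sup>2 - 3 / 2 * (- x) + (- x + - 2 * x) = x\<^sup>2 - 3 / 2 * x"
        by simp
      then show ?thesis
        by (simp only: powr_add[symmetric])
    qed
    ultimately show ?thesis
      by (simp only: mult.assoc[symmetric])
  qed
  then have "q powr (k\<^sup>2 - 3 / 2 * k) * \<bar>q_number (q\<^sup>2) k * q_number q k\<bar> =
      q powr (\<bar>k\<bar>\<^sup>2 - 3 / 2 * \<bar>k\<bar>) * \<bar>q_number (q\<^sup>2) \<bar>k\<bar> * q_number q \<bar>k\<bar>\<bar>"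
    by (cases "k \<ge> 0") (auto simp: abs_if)
  then show ?thesis
    using pos[of "\<bar>k\<bar>"] by simp
qed

end

context
  fixes q :: real
  assumes q: "0 < q" "q < 1"
begin

text \<open>
  The polynomials \<open>\<phi>\<close> and \<open>\<psi>\<close> absorb into the \<open>q\<close>-binomial coefficients with \<open>n\<close> and \<open>m\<close>, respectively. The
  resulting matrix of moments is a rescaled Hankel matrix in \<open>m + n - i - j\<close>.
\<close>
lemma lhs_sum_eq_selberg_value:
  assumes k0: "k0 = 1 / 2 \<or> k0 = 1"
    and n: "n = k0 + real J - 1" "n \<ge> 0" and m: "m = k0 + real A - 1" "m \<ge> 0"
  shows "lhs_sum q r m n = selberg_value q r m n"
proof -
  define \<phi> where "\<phi> j k = (\<Prod>l<j. (1 - q powr (n - k - real l)) * (1 - q powr (n + k - real l)))" for j k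
  define \<psi> where "\<psi> j k = (\<Prod>l<j. (1 - q powr (m - k - real l)) * (1 - q powr (m + k - real l)))" for j k
  define D where "D = q_euler q (2 * n + 1) * q_euler q (2 * m + 1)"
  define C where "C = 1 / ((1 - q) * (1 - q\<^sup>2) * (q_euler q 1)\<^sup>2 * D)"
  define \<Lambda> where "\<Lambda> = (\<Prod>i<r. \<Prod>l<i. q powr (m + n - 2 * real l))"
  define K where "K = (\<Prod>j<r. (1 / (1 - q) ^ 4) ^ j)"
  define V where "V k = (\<Prod>j<r. \<Prod>i<j. symmetric_lattice q (k (Suc j)) - symmetric_lattice q (k (Suc i)))" for k
  let ?w = "one_body_weight q m n"
  have \<Lambda>0: "\<Lambda> \<noteq> 0"
    using q by (simp add: \<Lambda>_def)
  have weight: "?w k = C * (q powr (\<bar>k\<bar>\<^sup>2 - 3 / 2 * \<bar>k\<bar>) * (1 - q powr (2 * \<bar>k\<bar>)) * (1 - q powr \<bar>k\<bar>) *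
      (q_euler q (n + \<bar>k\<bar> + 1) * q_euler q (n - \<bar>k\<bar> + 1) *
       (q_euler q (m + \<bar>k\<bar> + 1) * q_euler q (m - \<bar>k\<bar> + 1))))" if "k \<in> k_range n" for k
  proof -
    obtain i where i: "k = - n + real i"
      using \<open>k \<in> k_range n\<close> unfolding k_range_def by blast
    have twice: "\<exists>N. 2 * x = real N" if "x = k0 + real a - 1" "x \<ge> 0" for x and a :: nat
    proof (cases "k0 = 1")
      case True
      then show ?thesis
        using that by (intro exI[of _ "2 * a"]) simp
    next
      case False
      then have "a \<ge> 1"
        using that k0 by (cases a) auto
      then show ?thesis
        using that k0 False by (intro exI[of _ "2 * a - 1"]) (auto simp: of_nat_diff)
    qed
    have symm: "q_euler q (x + k + 1) * q_euler q (x - k + 1) =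
        q_euler q (x + \<bar>k\<bar> + 1) * q_euler q (x - \<bar>k\<bar> + 1)" for x
      by (cases "k \<ge> 0") (simp_all add: abs_if)
    have binom: "q_binomial q \<lfloor>2 * x\<rfloor> \<lfloor>x + k\<rfloor> =
        q_euler q (x + \<bar>k\<bar> + 1) * q_euler q (x - \<bar>k\<bar> + 1) / (q_euler q 1 * q_euler q (2 * x + 1))"
      if "x = k0 + real a - 1" "x \<ge> 0" for x and a :: nat
    proof -
      obtain N where N: "2 * x = real N"
        using twice[OF \<open>x = k0 + real a - 1\<close> \<open>x \<ge> 0\<close>] by blast
      define M where "M = int a - int J + int i"
      have M: "x + k = real_of_int M"
        using that n i by (simp add: M_def)
      have "real N - real_of_int M = x - k"
        using N M by simp
      moreover have "\<lfloor>2 * x\<rfloor> = int N" "\<lfloor>x + k\<rfloor> = M"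
        by (simp_all add: N M)
      ultimately have "q_binomial q \<lfloor>2 * x\<rfloor> \<lfloor>x + k\<rfloor> =
          q_euler q (x + k + 1) * q_euler q (x - k + 1) / (q_euler q 1 * q_euler q (2 * x + 1))"
        using q_binomial_eq_euler[OF q, of N M] by (simp only: M[symmetric] N[symmetric])
      then show ?thesis
        by (simp only: symm)
    qed
    show ?thesis
      unfolding one_body_weight_def base_weight_even[OF q] binom[OF n] binom[OF m] C_def D_def
      by (simp add: power2_eq_square mult_ac)
  qed
  have even: "\<phi> j \<bar>k\<bar> = \<phi> j k" "\<psi> j \<bar>k\<bar> = \<psi> j k" for j k
    by (cases "k \<ge> 0"; simp add: \<phi>_def \<psi>_def abs_if mult.commute)+
  have lower: "\<phi> i k * \<psi> j k * ?w k = C * moment_term q (n - real i) (m - real j) \<bar>k\<bar>"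
    if "k \<in> k_range n" for i j k
    unfolding weight[OF that] moment_term_def
      node_factors_lower_degree[OF q, symmetric] \<phi>_def[symmetric] \<psi>_def[symmetric] even
    by (simp only: mult_ac)
  have moment: "(\<Sum>k\<in>k_range n. \<phi> i k * \<psi> j k * ?w k) = 2 * C * moment_value q (n - real i) (m - real j)" for i j
  proof -
    have "(\<Sum>k\<in>k_range n. \<phi> i k * \<psi> j k * ?w k) =
        C * (\<Sum>k\<in>k_range n. moment_term q (n - real i) (m - real j) \<bar>k\<bar>)"
      unfolding sum_distrib_left by (intro sum.cong refl lower)
    also have "(\<Sum>k\<in>k_range n. moment_term q (n - real i) (m - real j) \<bar>k\<bar>) =
        2 * (\<Sum>l<J. moment_term q (n - real i) (m - real j) (k0 + real l))"
      by (rule k_range_sum_abs[OF q k0 n]) (use q in \<open>simp add: moment_term_def\<close>)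
    also have "(\<Sum>l<J. moment_term q (n - real i) (m - real j) (k0 + real l)) = moment_value q (n - real i) (m - real j)"
      by (rule moment_sum[OF q k0]) (simp_all add: n m)
    finally show ?thesis
      by simp
  qed
  have dets: "fdet r (\<lambda>i j. \<phi> j (k (Suc i))) * fdet r (\<lambda>i j. \<psi> j (k (Suc i))) = \<Lambda> * (V k)\<^sup>2" for k
  proof -
    have "fdet r (\<lambda>i j. \<phi> j (k (Suc i))) = (\<Prod>j<r. \<Prod>l<j. - (q powr (n - real l))) * V k"
      "fdet r (\<lambda>i j. \<psi> j (k (Suc i))) = (\<Prod>j<r. \<Prod>l<j. - (q powr (m - real l))) * V k"
      unfolding \<phi>_def \<psi>_def V_def node_factor[OF q] by (rule vandermonde_newton_basis)+
    moreover have "(\<Prod>j<r. \<Prod>l<j. - (q powr (n - real l))) * (\<Prod>j<r. \<Prod>l<j. - (q powr (m - real l))) = \<Lambda>"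
    proof -
      have "- (q powr (n - real l)) * - (q powr (m - real l)) = q powr (m + n - 2 * real l)" for l
      proof -
        have "n - real l + (m - real l) = m + n - 2 * real l"
          by simp
        then show ?thesis
          by (simp only: minus_mult_minus powr_add[symmetric])
      qed
      then show ?thesis
        unfolding \<Lambda>_def prod.distrib[symmetric] by (simp only:)
    qed
    ultimately show ?thesis
      by (simp add: power2_eq_square mult_ac)
  qed
  have "\<Lambda> * lhs_sum q r m n = K * (\<Sum>k \<in> {1..r} \<rightarrow>\<^sub>E k_range n.
      fdet r (\<lambda>i j. \<phi> j (k (Suc i))) * fdet r (\<lambda>i j. \<psi> j (k (Suc i))) * (\<Prod>i = 1..r. ?w (k i)))"
    unfolding lhs_sum_def summand_eq[OF q] dets K_def[symmetric] V_def[symmetric] sum_distrib_left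
    by (simp only: mult_ac)
  also have "\<dots> = K * (fact r * fdet r (\<lambda>i j. \<Sum>k\<in>k_range n. \<phi> i k * \<psi> j k * ?w k))"
    by (simp only: andreief[OF finite_k_range])
  also have "fdet r (\<lambda>i j. \<Sum>k\<in>k_range n. \<phi> i k * \<psi> j k * ?w k) =
      (\<Prod>i<r. 2 * (q powr (- (1 / 2)) * (1 - sqrt q) / ((1 - q) * (1 - q\<^sup>2) * q_euler (sqrt q) 1)) *
         (q_euler (sqrt q) (2 * n - 2 * real i) / D)) *
      (\<Prod>j<r. q_euler (sqrt q) (2 * m - 2 * real j)) *
      fdet r (\<lambda>i j. q_euler q (m + n + 1 - real i - real j) / q_euler q (m + n - 1 / 2 - real i - real j))"
  proof -
    have "q_euler q 1 \<noteq> 0"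
      by (rule q_euler_pos_nonzero[OF q]) simp
    then have CE: "C * q_euler q 1 ^ 2 = 1 / ((1 - q) * (1 - q\<^sup>2) * D)"
      by (simp add: C_def)
    have arg: "n - real i + (m - real j) + 1 = m + n + 1 - real i - real j"
      "n - real i + (m - real j) - 1 / 2 = m + n - 1 / 2 - real i - real j"
      "2 * (n - real i) = 2 * n - 2 * real i" "2 * (m - real j) = 2 * m - 2 * real j" for i j
      by simp_all
    have "2 * C * moment_value q (n - real i) (m - real j) =
        (2 * (q powr (- (1 / 2)) * (1 - sqrt q) / ((1 - q) * (1 - q\<^sup>2) * q_euler (sqrt q) 1)) *
         (q_euler (sqrt q) (2 * n - 2 * real i) / D)) *
        q_euler (sqrt q) (2 * m - 2 * real j) *
        (q_euler q (m + n + 1 - real i - real j) / q_euler q (m + n - 1 / 2 - real i - real j))" for i j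
    proof -
      have "2 * C * moment_value q (n - real i) (m - real j) =
        2 * (q powr (- (1 / 2)) * (1 - sqrt q) * (C * q_euler q 1 ^ 2) / q_euler (sqrt q) 1) *
        q_euler (sqrt q) (2 * n - 2 * real i) * q_euler (sqrt q) (2 * m - 2 * real j) *
        (q_euler q (m + n + 1 - real i - real j) / q_euler q (m + n - 1 / 2 - real i - real j))"
        unfolding moment_value_def arg by (simp add: mult_ac)
      then show ?thesis
        unfolding CE by (simp add: mult_ac)
    qed
    then show ?thesis
      unfolding moment by (simp only: fdet_scale)
  qed
  also have "fdet r (\<lambda>i j. q_euler q (m + n + 1 - real i - real j) / q_euler q (m + n - 1 / 2 - real i - real j)) =
      (\<Prod>i<r. q_euler q (m + n + 1 - real i) / q_euler q (m + n + 1 / 2 - real i - real r)) *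
      (\<Lambda> * q powr (- (\<Sum>s<r. (real s)\<^sup>2 + 3 / 2 * real s)) *
       (\<Prod>i<r. \<Prod>l = 1..i. (1 - q powr real l) * (1 - q powr (real l + 1 / 2))))"
  proof -
    \<comment> \<open>\<open>m + n\<close> is an integer in both cases.\<close>
    have "m + n - 1 / 2 \<notin> \<int>"
    proof
      assume "m + n - 1 / 2 \<in> \<int>"
      then obtain z where "m + n - 1 / 2 = of_int z"
        by (auto elim: Ints_cases)
      then have "real_of_int (4 * int J + 4 * int A - 10 + (if k0 = 1 then 8 else 4)) = 4 * of_int z"
        using n m k0 by auto
      then have "4 * int J + 4 * int A - 10 + (if k0 = 1 then 8 else 4) = 4 * z"
        by linarith
      then have "4 * int J + 4 * int A - 2 = 4 * z \<or> 4 * int J + 4 * int A - 6 = 4 * z"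
        by (simp split: if_splits)
      then show False
        by presburger
    qed
    moreover have "m + n - 1 / 2 - real i - (real r - 1) = m + n + 1 / 2 - real i - real r" for i
      by simp
    ultimately show ?thesis
      unfolding \<Lambda>_def triangle_product[OF q, symmetric] using det_euler_ratio[OF q, of "m + n - 1 / 2" r "m + n + 1"]
      by (simp only: simp_thms)
  qed
  finally have "\<Lambda> * lhs_sum q r m n = \<Lambda> * selberg_value q r m n"
    unfolding selberg_value_def selberg_const_def K_def[symmetric] D_def[symmetric] mult.assoc[symmetric]
    by (simp add: prod.distrib prod_dividef power_mult_distrib power_divide mult_ac)
  then show ?thesis
    using \<Lambda>0 by simp
qed

end

section \<open>The \<open>q\<close>-Gamma form and its limit\<close>

lemma binomial_exponent:
  "- 2 * real ((r + 1) choose 3) - 1 / 2 * real ((r + 1) choose 2) =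
   - (1 / 2) * real r + - (\<Sum>s<r. (real s)\<^sup>2 + 3 / 2 * real s)"
proof (induction r)
  case (Suc r)
  have two: "real ((s + 1) choose 2) = real s * (real s + 1) / 2" for s
    by (induction s) (simp_all add: numeral_2_eq_2 field_simps)
  have "(Suc r + 1) choose 3 = ((r + 1) choose 2) + ((r + 1) choose 3)"
    by (simp add: eval_nat_numeral)
  then have three: "real ((Suc r + 1) choose 3) = real r * (real r + 1) / 2 + real ((r + 1) choose 3)"
    by (simp only: of_nat_add two)
  show ?case
    unfolding sum.lessThan_Suc two three using Suc.IH[unfolded two]
    by (simp add: power2_eq_square field_simps)
qed (simp add: eval_nat_numeral)

context
  fixes q :: real
  assumes q: "0 < q" "q < 1"
begin

text \<open>
  Off the poles the quotient of \<open>\<Gamma>\<close> to base \<open>\<surd>q\<close> at \<open>2 x - 1\<close> by \<open>\<Gamma>\<^sub>q(x)\<close> simplifies by the duplication formula. The powers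
  of \<open>1 - q\<close> and \<open>1 - \<surd>q\<close> that come from the \<open>q\<close>-Gamma functions then add up to the constant in
  \<open>selberg_const\<close>.
\<close>
lemma rhs_product_eq_selberg_value:
  assumes no_pole: "\<And>i. i < r \<Longrightarrow> 2 * m + 2 * n - 2 * real i - 2 * real r + 1 \<notin> \<int>\<^sub>\<le>\<^sub>0"
  shows "rhs_product q r m n = selberg_value q r m n"
proof -
  define p where "p = sqrt q"
  define N where "N = m + n"
  have p: "0 < p" "p < 1" "q powr (1 / 2) = p" "q = p\<^sup>2"
    using q by (auto simp: p_def powr_half_sqrt)
  define T where "T i = (\<Prod>l = 1..i. (1 - q powr real l) * (1 - q powr (real l + 1 / 2)))" for i
  define Q where "Q i = q_euler p (2 * n - 2 * real i) * q_euler p (2 * m - 2 * real i) *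
        q_euler q (m + n + 1 - real i) /
        (q_euler q (2 * n + 1) * q_euler q (2 * m + 1) * q_euler q (m + n + 1 / 2 - real i - real r))" for i
  have ne: "q_euler q 1 \<noteq> 0" "q_euler p 1 \<noteq> 0" "q_euler p (2 * real i + 2) \<noteq> 0" for i
    by (auto intro!: q_euler_pos_nonzero[OF q] q_euler_pos_nonzero[OF p(1,2)])
  have factor: "(q_Gamma p (2 * real (Suc i)) * q_Gamma q (2 * n + 1) * q_Gamma q (2 * m + 1) /
         (q_Gamma q (m + n - real (Suc i) + 2) * q_Gamma q (m + n - real (Suc i) - real r + 2))) *
        (q_Gamma p (2 * m + 2 * n - 2 * real (Suc i) - 2 * real r + 3) /
         (q_Gamma p (2 * n - 2 * real (Suc i) + 2) * q_Gamma p (2 * m - 2 * real (Suc i) + 2))) =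
      (1 - p) powr (2 * real r - 3 - 4 * real i) * (1 - q) powr (- 2 * real i - real r) *
      ((1 - p) / q_euler p 1 * T i) * Q i" if "i < r" for i
  proof -
    have G: "q_Gamma b x = (1 - b) powr (1 - x) * (q_euler b 1 / q_euler b x)" if "b > 0" for b x
      using that by (simp add: q_Gamma_def q_euler_def)
    have arg1: "2 * real (Suc i) = 2 * real i + 2"
      by simp
    have arg: "m + n - real (Suc i) + 2 = m + n + 1 - real i"
      "m + n - real (Suc i) - real r + 2 = m + n - real i - real r + 1"
      "2 * m + 2 * n - 2 * real (Suc i) - 2 * real r + 3 = 2 * m + 2 * n - 2 * real i - 2 * real r + 1"
      "2 * n - 2 * real (Suc i) + 2 = 2 * n - 2 * real i" "2 * m - 2 * real (Suc i) + 2 = 2 * m - 2 * real i"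
      by simp_all
    have dup: "q_euler p (2 * m + 2 * n - 2 * real i - 2 * real r + 1) =
        q_euler q (m + n + 1 / 2 - real i - real r) * q_euler q (m + n - real i - real r + 1)"
    proof -
      have "2 * m + 2 * n - 2 * real i - 2 * real r + 1 = 2 * (m + n + 1 / 2 - real i - real r)"
        "m + n - real i - real r + 1 = m + n + 1 / 2 - real i - real r + 1 / 2"
        by simp_all
      then show ?thesis
        unfolding p_def using q_euler_duplication[OF q] by metis
    qed
    have ne': "q_euler q (m + n - real i - real r + 1) \<noteq> 0"
      using no_pole[OF that] q_euler_eq_0_iff[OF p(1,2)] dup by force
    have even: "q_euler p 1 = (1 - p) * T i * q_euler p (2 * real i + 2)"
      unfolding T_def p_def by (rule q_euler_1_even[OF q])
    have T: "(1 - p) / q_euler p 1 * T i = 1 / q_euler p (2 * real i + 2)"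
    proof -
      have "p \<noteq> 1" "T i \<noteq> 0"
        using ne(2) even by auto
      then show ?thesis
        unfolding even by simp
    qed
    have P1: "(1 - p) powr (1 - (2 * real i + 2)) * (1 - p) powr (1 - (2 * m + 2 * n - 2 * real i - 2 * real r + 1)) /
        ((1 - p) powr (1 - (2 * n - 2 * real i)) * (1 - p) powr (1 - (2 * m - 2 * real i))) =
        (1 - p) powr (2 * real r - 3 - 4 * real i)"
    proof -
      have "1 - (2 * real i + 2) + (1 - (2 * m + 2 * n - 2 * real i - 2 * real r + 1)) -
          (1 - (2 * n - 2 * real i) + (1 - (2 * m - 2 * real i))) = 2 * real r - 3 - 4 * real i"
        by simp
      then show ?thesis
        by (simp only: powr_add[symmetric] powr_diff[symmetric])
    qed
    have P2: "(1 - q) powr (1 - (2 * n + 1)) * (1 - q) powr (1 - (2 * m + 1)) /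
        ((1 - q) powr (1 - (m + n + 1 - real i)) * (1 - q) powr (1 - (m + n - real i - real r + 1))) =
        (1 - q) powr (- 2 * real i - real r)"
    proof -
      have "1 - (2 * n + 1) + (1 - (2 * m + 1)) -
          (1 - (m + n + 1 - real i) + (1 - (m + n - real i - real r + 1))) = - 2 * real i - real r"
        by simp
      then show ?thesis
        by (simp only: powr_add[symmetric] powr_diff[symmetric])
    qed
    have E: "(q_euler p 1 / q_euler p (2 * real i + 2)) * (q_euler q 1 / q_euler q (2 * n + 1)) *
        (q_euler q 1 / q_euler q (2 * m + 1)) /
        ((q_euler q 1 / q_euler q (m + n + 1 - real i)) * (q_euler q 1 / q_euler q (m + n - real i - real r + 1))) *
        ((q_euler p 1 / q_euler p (2 * m + 2 * n - 2 * real i - 2 * real r + 1)) /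
         ((q_euler p 1 / q_euler p (2 * n - 2 * real i)) * (q_euler p 1 / q_euler p (2 * m - 2 * real i)))) =
        1 / q_euler p (2 * real i + 2) * Q i"
      unfolding Q_def dup using ne(1,2) ne' by (simp add: mult_ac)
    have rearrange: "(a1 * e1 * (a2 * e2) * (a3 * e3) / ((a4 * e4) * (a5 * e5))) * ((a6 * e6) / ((a7 * e7) * (a8 * e8))) =
        (a1 * a6 / (a7 * a8)) * (a2 * a3 / (a4 * a5)) * (e1 * e2 * e3 / (e4 * e5) * (e6 / (e7 * e8)))"
      for a1 a2 a3 a4 a5 a6 a7 a8 e1 e2 e3 e4 e5 e6 e7 e8 :: real
      by (simp add: mult_ac)
    show ?thesis
      unfolding arg unfolding arg1 G[OF p(1)] G[OF q(1)] rearrange P1 P2 E T by (simp only: mult.assoc)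
  qed
  have c1: "(\<Prod>i<r. (1 - p) powr (2 * real r - 3 - 4 * real i)) = 1 / (1 - p) ^ r"
  proof -
    have "(\<Sum>i<r'. c - 3 - 4 * real i) = real r' * c - real r' * (2 * real r' + 1)" for r' c
      by (induction r') (simp_all add: algebra_simps)
    then have "(\<Sum>i<r. 2 * real r - 3 - 4 * real i) = real r * (2 * real r) - real r * (2 * real r + 1)" .
    also have "\<dots> = - real r"
      by (simp add: algebra_simps)
    finally have exponent: "(\<Sum>i<r. 2 * real r - 3 - 4 * real i) = - real r" .
    have "(\<Prod>i<r. (1 - p) powr (2 * real r - 3 - 4 * real i)) = (1 - p) powr (- real r)"
      unfolding exponent[symmetric] by (rule powr_sum[symmetric]) (use p(2) in simp)
    also have "\<dots> = 1 / (1 - p) ^ r"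
      using p(2) by (simp add: powr_minus powr_realpow divide_inverse)
    finally show ?thesis .
  qed
  \<comment> \<open>The leftover \<open>(1 - q) ^ r\<close> combines in the next step with those of \<open>1 - p\<close> and \<open>1 + p\<close>.\<close>
  have c2: "(\<Prod>i<r. (1 - q) powr (- 2 * real i - real r)) = (\<Prod>j<r. (1 / (1 - q) ^ 4) ^ j) / (1 - q) ^ r"
  proof -
    have s1: "(\<Sum>i<r'. - 2 * real i - c) = - (real r' * (real r' - 1)) - real r' * c" for r' c
    proof (induction r')
      case (Suc r')
      show ?case
        unfolding sum.lessThan_Suc Suc.IH by (simp add: algebra_simps)
    qed simp
    have s2: "(\<Sum>i<r'. - 4 * real i) = - 2 * (real r' * (real r' - 1))" for r'
    proof (induction r')
      case (Suc r')
      show ?case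
        unfolding sum.lessThan_Suc Suc.IH by (simp add: algebra_simps)
    qed simp
    have "(1 / (1 - q) ^ 4) ^ j = (1 - q) powr (- 4 * real j)" for j
    proof -
      have "(1 / (1 - q) ^ 4) ^ j = 1 / (1 - q) ^ (4 * j)"
        by (simp add: power_divide power_mult)
      also have "\<dots> = (1 - q) powr (- real (4 * j))"
        using q(2) by (simp add: powr_minus powr_realpow[of "1 - q"] divide_inverse del: of_nat_mult)
      finally show ?thesis
        by simp
    qed
    then have "(\<Prod>j<r. (1 / (1 - q) ^ 4) ^ j) = (1 - q) powr (- 2 * (real r * (real r - 1)))"
      unfolding s2[symmetric] using q(2) by (simp only:) (rule powr_sum[symmetric], simp)
    moreover have "(1 - q) ^ r = (1 - q) powr real r"
      using q by (simp add: powr_realpow)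
    moreover have "(\<Prod>i<r. (1 - q) powr (- 2 * real i - real r)) =
        (1 - q) powr (- (real r * (real r - 1)) - real r * real r)"
      unfolding s1[symmetric] by (rule powr_sum[symmetric]) (use q(2) in simp)
    moreover have "- (real r * (real r - 1)) - real r * real r = - 2 * (real r * (real r - 1)) - real r"
      by (simp add: algebra_simps)
    ultimately show ?thesis
      by (simp only: powr_diff)
  qed
  have c3: "(2 / q_number q 2) ^ r * q_number p 2 powi (- int r) * (1 / (1 - p) ^ r) *
      (1 / (1 - q) ^ r) * ((1 - p) / q_euler p 1) ^ r =
      (2 * ((1 - p) / ((1 - q) * (1 - q\<^sup>2) * q_euler p 1))) ^ r"
  proof -
    have "q_number p 2 = 1 + p" "q_number q 2 = (1 - q\<^sup>2) / (1 - q)"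
      using p q by (simp_all add: q_number_def power2_eq_square divide_simps) (simp add: algebra_simps)
    moreover have "(1 + p) * (1 - p) = 1 - q"
      by (simp add: p(4) power2_eq_square algebra_simps)
    ultimately have "(2 / q_number q 2) * inverse (q_number p 2) * (1 / (1 - p)) * (1 / (1 - q)) * ((1 - p) / q_euler p 1) =
        2 / ((1 - q\<^sup>2) / (1 - q)) * (1 / (1 - q)) * (1 / (1 - q)) * ((1 - p) / q_euler p 1)"
      by (simp add: divide_inverse mult_ac flip: inverse_mult_distrib)
    also have "\<dots> = 2 * ((1 - p) / ((1 - q) * (1 - q\<^sup>2) * q_euler p 1))"
    proof -
      have cancel: "2 / (b / a) * (1 / a) * (1 / a) * (c / e) = 2 * (c / (a * b * e))" if "a \<noteq> 0" for a b c e :: real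
        using that by simp
      show ?thesis
        by (rule cancel) (use q(2) in simp)
    qed
    finally have base: "(2 / q_number q 2) * inverse (q_number p 2) * (1 / (1 - p)) * (1 / (1 - q)) *
        ((1 - p) / q_euler p 1) = 2 * ((1 - p) / ((1 - q) * (1 - q\<^sup>2) * q_euler p 1))" .
    have "q_number p 2 powi (- int r) = inverse (q_number p 2) ^ r"
      by (simp add: power_int_minus power_inverse)
    then show ?thesis
      by (simp only: power_one_over[symmetric] power_mult_distrib[symmetric] base)
  qed
  have c4: "q powr (- 2 * real ((r + 1) choose 3) - 1 / 2 * real ((r + 1) choose 2)) =
      (q powr (- (1 / 2))) ^ r * q powr (- (\<Sum>s<r. (real s)\<^sup>2 + 3 / 2 * real s))"
  proof -
    have "q powr (- (1 / 2) * real r) = (q powr (- (1 / 2))) ^ r"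
      using q by (simp add: powr_power mult_ac)
    then show ?thesis
      by (simp only: binomial_exponent powr_add)
  qed
  have c5: "(2 * ((1 - p) / ((1 - q) * (1 - q\<^sup>2) * q_euler p 1))) ^ r * (q powr (- (1 / 2))) ^ r =
      (2 * (q powr (- (1 / 2)) * (1 - p) / ((1 - q) * (1 - q\<^sup>2) * q_euler p 1))) ^ r"
    unfolding power_mult_distrib[symmetric] by (simp only: mult_ac times_divide_eq_right)
  have "rhs_product q r m n = fact r * (2 / q_number q 2) ^ r * q_number p 2 powi (- int r) *
      q powr (- 2 * real ((r + 1) choose 3) - 1 / 2 * real ((r + 1) choose 2)) *
      (\<Prod>i<r. (1 - p) powr (2 * real r - 3 - 4 * real i) * (1 - q) powr (- 2 * real i - real r) *
      ((1 - p) / q_euler p 1 * T i) * Q i)"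
    unfolding rhs_product_def p(3) prod.atLeast1_atMost_eq[folded One_nat_def]
    by (rule arg_cong2[where f = "(*)", OF refl], rule prod.cong[OF refl], rule factor, simp)
  also have "\<dots> = fact r * (((2 / q_number q 2) ^ r * q_number p 2 powi (- int r) * (1 / (1 - p) ^ r) *
      (1 / (1 - q) ^ r) * ((1 - p) / q_euler p 1) ^ r) * (q powr (- (1 / 2))) ^ r *
      (\<Prod>j<r. (1 / (1 - q) ^ 4) ^ j) *
      q powr (- (\<Sum>s<r. (real s)\<^sup>2 + 3 / 2 * real s)) * (\<Prod>i<r. T i) * (\<Prod>i<r. Q i))"
    unfolding prod.distrib c1 c2 c4 by (simp add: mult_ac)
  also have "\<dots> = selberg_value q r m n"
    unfolding c3 selberg_value_def selberg_const_def Q_def T_def p_def[symmetric] c5[symmetric]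
    by (simp only: mult_ac)
  finally show ?thesis .
qed

lemma isCont_q_euler_compose: "isCont f a \<Longrightarrow> isCont (\<lambda>x. q_euler q (f x)) a"
  by (rule isCont_o2[OF _ isCont_q_euler[OF q]])

end

lemma isCont_selberg_value:
  assumes q: "0 < q" "q < 1"
    and "2 * n + 1 > 0" "2 * m + 1 > 0" "\<And>i. i < r \<Longrightarrow> m + n + 1 / 2 - real i - real r \<notin> \<int>\<^sub>\<le>\<^sub>0"
  shows "isCont (\<lambda>\<epsilon>. selberg_value q r (m + \<epsilon>) (n + \<epsilon>)) 0"
proof -
  have sq: "0 < sqrt q" "sqrt q < 1"
    using q by auto
  show ?thesis
    unfolding selberg_value_def using assms(3-)
    by (intro continuous_intros isCont_q_euler_compose[OF q] isCont_q_euler_compose[OF sq])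
      (auto simp: q_euler_eq_0_iff[OF q] elim!: nonpos_Ints_cases)
qed

theorem proposition6p5:
  fixes q m n :: real and r :: nat
  assumes "0 < q" and "q < 1" and "r \<ge> 1"
    and "(m \<in> \<nat> \<and> n \<in> \<nat>) \<or>
         ((\<exists>a::nat. m = real a + 1 / 2) \<and> (\<exists>b::nat. n = real b + 1 / 2))"
  shows "if rhs_numerator_pole r m n
         then ((\<lambda>\<epsilon>. rhs_product q r (m + \<epsilon>) (n + \<epsilon>)) \<longlongrightarrow> lhs_sum q r m n) (at 0)
         else lhs_sum q r m n = rhs_product q r m n"
proof -
  note q = \<open>0 < q\<close> \<open>q < 1\<close>
  obtain k0 J A where k0: "k0 = 1 / 2 \<or> k0 = 1" and n: "n = k0 + real J - 1" "n \<ge> 0"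
    and m: "m = k0 + real A - 1" "m \<ge> 0"
    using assms(4)
  proof
    assume "m \<in> \<nat> \<and> n \<in> \<nat>"
    then obtain a b where "m = real a" "n = real b"
      by (auto elim!: Nats_cases)
    then show thesis
      by (intro that[of 1 b a]) auto
  next
    assume "(\<exists>a::nat. m = real a + 1 / 2) \<and> (\<exists>b::nat. n = real b + 1 / 2)"
    then obtain a b where "m = real a + 1 / 2" "n = real b + 1 / 2"
      by blast
    then show thesis
      by (intro that[of "1 / 2" "Suc b" "Suc a"]) auto
  qed
  have lhs: "lhs_sum q r m n = selberg_value q r m n"
    by (rule lhs_sum_eq_selberg_value[OF q k0 n m])
  define z where "z = int J + int A - 2 + (if k0 = 1 then 2 else 1)"
  have z: "m + n = of_int z"
    using k0 n m by (auto simp: z_def)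
  show ?thesis
  proof (cases "rhs_numerator_pole r m n")
    case True
    have "isCont (\<lambda>\<epsilon>. selberg_value q r (m + \<epsilon>) (n + \<epsilon>)) 0"
    proof (rule isCont_selberg_value[OF q])
      fix i
      show "m + n + 1 / 2 - real i - real r \<notin> \<int>\<^sub>\<le>\<^sub>0"
      proof
        assume "m + n + 1 / 2 - real i - real r \<in> \<int>\<^sub>\<le>\<^sub>0"
        then obtain y where "m + n + 1 / 2 - real i - real r = of_int y"
          by (auto elim!: nonpos_Ints_cases)
        then have "real_of_int (2 * z + 1 - 2 * int i - 2 * int r) = real_of_int (2 * y)"
          using z by simp
        then have "2 * z + 1 - 2 * int i - 2 * int r = 2 * y"
          by linarith
        then show False
          by presburger
      qed
    qed (use n m in auto)
    then have "((\<lambda>\<epsilon>. selberg_value q r (m + \<epsilon>) (n + \<epsilon>)) \<longlongrightarrow> lhs_sum q r m n) (at 0)"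
      by (simp add: isCont_def lhs)
    moreover have "\<forall>\<^sub>F \<epsilon> in at 0. rhs_product q r (m + \<epsilon>) (n + \<epsilon>) = selberg_value q r (m + \<epsilon>) (n + \<epsilon>)"
    proof -
      \<comment> \<open>A pole at \<open>\<epsilon>\<close> would force \<open>4 * \<epsilon>\<close> to be an integer.\<close>
      have "\<forall>\<^sub>F \<epsilon> :: real in at 0. \<epsilon> \<noteq> 0 \<and> \<bar>\<epsilon>\<bar> < 1 / 4"
        by (auto simp: eventually_at intro!: exI[of _ "1 / 4"])
      then show ?thesis
      proof eventually_elim
        case (elim \<epsilon>)
        show ?case
        proof (rule rhs_product_eq_selberg_value[OF q])
          fix i
          show "2 * (m + \<epsilon>) + 2 * (n + \<epsilon>) - 2 * real i - 2 * real r + 1 \<notin> \<int>\<^sub>\<le>\<^sub>0"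
          proof
            assume "2 * (m + \<epsilon>) + 2 * (n + \<epsilon>) - 2 * real i - 2 * real r + 1 \<in> \<int>\<^sub>\<le>\<^sub>0"
            then obtain y where "2 * (m + \<epsilon>) + 2 * (n + \<epsilon>) - 2 * real i - 2 * real r + 1 = of_int y"
              by (auto elim!: nonpos_Ints_cases)
            then have "4 * \<epsilon> = real_of_int (y - 2 * z + 2 * int i + 2 * int r - 1)"
              using z by simp
            then obtain t :: int where "4 * \<epsilon> = of_int t"
              by blast
            then have "\<bar>real_of_int t\<bar> < 1" "t \<noteq> 0"
              using elim by auto
            then show False
              by linarith
          qed
        qed
      qed
    qed
    ultimately have "((\<lambda>\<epsilon>. rhs_product q r (m + \<epsilon>) (n + \<epsilon>)) \<longlongrightarrow> lhs_sum q r m n) (at 0)"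
      using tendsto_cong by fast
    then show ?thesis
      using True by simp
  next
    case False
    have "rhs_product q r m n = selberg_value q r m n"
    proof (rule rhs_product_eq_selberg_value[OF q])
      fix i assume "i < r"
      then have "Suc i \<in> {1..r}"
        by simp
      with False have "2 * m + 2 * n - 2 * real (Suc i) - 2 * real r + 3 \<notin> \<int>\<^sub>\<le>\<^sub>0"
        unfolding rhs_numerator_pole_def by blast
      then show "2 * m + 2 * n - 2 * real i - 2 * real r + 1 \<notin> \<int>\<^sub>\<le>\<^sub>0"
        by (simp add: algebra_simps)
    qed
    then show ?thesis
      using False lhs by simp
  qed
qed

end
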